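(* Let $\langle\mathbb A,\alpha\rangle$, $\langle\mathbb B,\beta\rangle$ be countable incompressible dynamical systems, $\iota$ an embedding of $\langle\mathbb A,\alpha\rangle$ into $\langle\mathbb B,\beta\rangle$, and $\eta$ an embedding of $\langle\mathbb A,\alpha\rangle$ into $\langle\mathcal P(\omega)/\mathrm{Fin},\sigma\rangle$. If $\langle\mathbb A,\alpha\rangle$ is polarized, then there is an embedding $\bar\eta$ of $\langle\mathbb B,\beta\rangle$ into $\langle\mathcal P(\omega)/\mathrm{Fin},\sigma\rangle$ with $\bar\eta\circ\iota=\eta$.
   Context: $\mathcal P(\omega)/\mathrm{Fin}$ is $\mathcal P(\omega)$ modulo finite sets, $\sigma([A])=[A+1]$. Dynamical system: Boolean algebra with automorphism; embedding: injective Boolean homomorphism commuting with the automorphisms; incompressible: no $x\notin\{\mathbf 0,\mathbf 1\}$ with $\alpha(x)\le x$. A partition of $\mathbb A$ is a finite set of nonzero pairwise disjoint elements with join $\mathbf 1$; $\mathcal A'$ refines $\mathcal A$ if each member of $\mathcal A'$ is below a member of $\mathcal A$, and the natural map $\pi:\mathcal A'\to\mathcal A$ sends $x$ to the member of $\mathcal A$ above it. The digraph $\langle\mathcal A,\to_\alpha\rangle$ has $x\to_\alpha y$ iff $\alpha(x)\wedge y\ne\mathbf 0$. Digraphs are finite; strongly connected means any vertex reaches any vertex by a walk. An epimorphism from $\langle\mathcal V,\to_{\mathcal V}\rangle$ onto $\langle\mathcal U,\to_{\mathcal U}\rangle$ is a surjection $\phi:\mathcal V\to\mathcal U$ such that $u\to_{\mathcal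 U}u'$ iff there are $v\in\phi^{-1}(u),v'\in\phi^{-1}(u')$ with $v\to_{\mathcal V}v'$. A virtual refinement of $\langle\mathcal A,\to_\alpha\rangle$ is a pair $(\phi,\langle\mathcal V,\to\rangle)$ with $\langle\mathcal V,\to\rangle$ strongly connected and $\phi$ an epimorphism onto $\langle\mathcal A,\to_\alpha\rangle$; a partition $\mathcal A'$ realizes it if $\mathcal A'$ refines $\mathcal A$ and there is a digraph isomorphism $\psi:\langle\mathcal V,\to\rangle\to\langle\mathcal A',\to_\alpha\rangle$ with $\pi\circ\psi=\phi$. Two epimorphisms $\phi:\langle\mathcal U,\to_{\mathcal U}\rangle\to\langle\mathcal A,\to\rangle$, $\psi:\langle\mathcal V,\to_{\mathcal V}\rangle\to\langle\mathcal A,\to\rangle$ between strongly connected digraphs are compatible if there are a strongly connected digraph $\langle\mathcal W,\to_{\mathcal W}\rangle$ and epimorphisms $\bar\phi$ onto $\langle\mathcal U,\to_{\mathcal U}\rangle$ and $\bar\psi$ onto $\langle\mathcal V,\to_{\mathcal V}\rangle$ with $\phi\circ\bar\phi=\psi\circ\bar\psi$; otherwise incompatible. A virtual refinement $(\phi,\langle\mathcal V,\to\rangle)$ of $\langle\mathcal A,\to_\alpha\rangle$ is polarized if either some partition of $\mathbb A$ realizes it, or there is a partition $\mathcal A'$ of $\mathbb A$ refining $\mathcal A$ such that $\phi$ and the natural map $\pi:\langle\mathcal A',\to_\alpha\rangle\to\langle\mathcal A,\to_\alpha\rangle$ are incompatible. $\langle\mathbb A,\alpha\rangle$ is polarized if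 every virtual refinement of $\langle\mathcal A,\to_\alpha\rangle$, for every partition $\mathcal A$ of $\mathbb A$, is polarized. *)

theory Defs
  imports "HOL-Library.Countable_Set" "Graph_Theory.Graph_Theory"
begin

section \<open>Boolean algebras and dynamical systems\<close>

definition boolean_hom :: "('a::boolean_algebra \<Rightarrow> 'b::boolean_algebra) \<Rightarrow> bool" where
  "boolean_hom f \<longleftrightarrow>
     (\<forall>x y. f (inf x y) = inf (f x) (f y)) \<and>
     (\<forall>x y. f (sup x y) = sup (f x) (f y)) \<and>
     (\<forall>x. f (- x) = - f x) \<and> f bot = bot \<and> f top = top"

definition dynamical_system :: "('a::boolean_algebra \<Rightarrow> 'a) \<Rightarrow> bool" where
  "dynamical_system \<alpha> \<longleftrightarrow> boolean_hom \<alpha> \<and> bij \<alpha>"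

definition embedding ::
  "('a::boolean_algebra \<Rightarrow> 'a) \<Rightarrow> ('b::boolean_algebra \<Rightarrow> 'b) \<Rightarrow> ('a \<Rightarrow> 'b) \<Rightarrow> bool" where
  "embedding \<alpha> \<beta> \<iota> \<longleftrightarrow> boolean_hom \<iota> \<and> inj \<iota> \<and> \<iota> \<circ> \<alpha> = \<beta> \<circ> \<iota>"

definition incompressible :: "('a::boolean_algebra \<Rightarrow> 'a) \<Rightarrow> bool" where
  "incompressible \<alpha> \<longleftrightarrow> (\<nexists>x. x \<notin> {bot, top} \<and> \<alpha> x \<le> x)"


section \<open>The algebra of sets of naturals modulo finite sets, and the shift\<close>

definition eq_mod_fin :: "nat set \<Rightarrow> nat set \<Rightarrow> bool" where
  "eq_mod_fin A B \<longleftrightarrow> finite ((A - B) \<union> (B - A))"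

lemma eq_mod_fin_alt: "eq_mod_fin A B \<longleftrightarrow> (\<forall>\<^sub>F n in cofinite. n \<in> A \<longleftrightarrow> n \<in> B)"
  unfolding eq_mod_fin_def eventually_cofinite
  by (rule arg_cong[where f = finite]) auto

quotient_type pow_fin = "nat set" / eq_mod_fin
  morphisms rep_pow_fin class_mod_fin
proof (rule equivpI)
  show "reflp eq_mod_fin" by (simp add: reflp_def eq_mod_fin_def)
  show "symp eq_mod_fin" by (simp add: symp_def eq_mod_fin_def Un_commute)
  show "transp eq_mod_fin"
    unfolding transp_def eq_mod_fin_alt by (intro allI impI) (erule (1) eventually_elim2, simp)
qed

instantiation pow_fin :: boolean_algebra
begin

lift_definition inf_pow_fin :: "pow_fin \<Rightarrow> pow_fin \<Rightarrow> pow_fin" is "(\<inter>)"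
  unfolding eq_mod_fin_alt by (erule (1) eventually_elim2, simp)

lift_definition sup_pow_fin :: "pow_fin \<Rightarrow> pow_fin \<Rightarrow> pow_fin" is "(\<union>)"
  unfolding eq_mod_fin_alt by (erule (1) eventually_elim2, simp)

lift_definition minus_pow_fin :: "pow_fin \<Rightarrow> pow_fin \<Rightarrow> pow_fin" is "(-)"
  unfolding eq_mod_fin_alt by (erule (1) eventually_elim2, simp)

lift_definition uminus_pow_fin :: "pow_fin \<Rightarrow> pow_fin" is "uminus"
  unfolding eq_mod_fin_alt by simp

lift_definition bot_pow_fin :: pow_fin is "{}" .

lift_definition top_pow_fin :: pow_fin is "UNIV" .

lift_definition less_eq_pow_fin :: "pow_fin \<Rightarrow> pow_fin \<Rightarrow> bool" is "\<lambda>A B. finite (A - B)"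
proof -
  fix A A' B B' assume *: "eq_mod_fin A A'" "eq_mod_fin B B'"
  have "finite (A - B) \<longleftrightarrow> (\<forall>\<^sub>F n in cofinite. n \<in> A \<longrightarrow> n \<in> B)" for A B :: "nat set"
    unfolding eventually_cofinite by (rule arg_cong[where f = finite]) auto
  moreover have "\<forall>\<^sub>F n in cofinite. (n \<in> A \<longrightarrow> n \<in> B) \<longleftrightarrow> (n \<in> A' \<longrightarrow> n \<in> B')"
    using * unfolding eq_mod_fin_alt by (rule eventually_elim2) simp
  ultimately show "finite (A - B) \<longleftrightarrow> finite (A' - B')"
    using eventually_cong by simp
qed

definition less_pow_fin :: "pow_fin \<Rightarrow> pow_fin \<Rightarrow> bool" where
  "less_pow_fin x y \<longleftrightarrow> x \<le> y \<and> \<not> y \<le> x"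

instance
proof
  fix x y z :: pow_fin
  have *: "finite (A - B)" if "A \<subseteq> B" for A B :: "nat set"
    using that by (metis Diff_eq_empty_iff finite.emptyI)
  show "(x < y) = (x \<le> y \<and> \<not> y \<le> x)" by (rule less_pow_fin_def)
  show "x \<le> x" by transfer simp
  show "x \<le> z" if "x \<le> y" "y \<le> z"
  proof (use that in transfer)
    fix A B C :: "nat set" assume "finite (A - B)" "finite (B - C)"
    then have "finite ((A - B) \<union> (B - C))" by simp
    then show "finite (A - C)" by (rule rev_finite_subset) auto
  qed
  show "x = y" if "x \<le> y" "y \<le> x" using that by transfer (simp add: eq_mod_fin_def)
  show "inf x y \<le> x" "inf x y \<le> y" "x \<le> sup x y" "y \<le> sup x y" "bot \<le> x" "x \<le> top"
    by (transfer; rule *; blast)+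
  show "x \<le> inf y z" if "x \<le> y" "x \<le> z" using that by transfer (simp add: Diff_Int)
  show "sup y z \<le> x" if "y \<le> x" "z \<le> x" using that by transfer (simp add: Un_Diff)
  show "sup x (inf y z) = inf (sup x y) (sup x z)"
    by transfer (simp add: Un_Int_distrib eq_mod_fin_def)
  show "inf x (- x) = bot" by transfer (simp add: eq_mod_fin_def)
  show "sup x (- x) = top" by transfer (simp add: eq_mod_fin_def)
  show "x - y = inf x (- y)" by transfer (auto simp: eq_mod_fin_alt)
qed

end

lift_definition shift :: "pow_fin \<Rightarrow> pow_fin" is "image Suc"
proof -
  fix A B :: "nat set" assume "eq_mod_fin A B"
  then have "finite (Suc ` ((A - B) \<union> (B - A)))" by (simp add: eq_mod_fin_def)
  moreover have "Suc ` ((A - B) \<union> (B - A)) = (Suc ` A - Suc ` B) \<union> (Suc ` B - Suc ` A)" by auto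
  ultimately show "eq_mod_fin (Suc ` A) (Suc ` B)" by (simp add: eq_mod_fin_def)
qed

lemma dynamical_system_shift: "dynamical_system shift"
proof -
  have cofin: "(\<forall>\<^sub>F n in cofinite. P n) \<longleftrightarrow> (\<forall>\<^sub>F n in cofinite. P (Suc n))" for P
    unfolding cofinite_eq_sequentially by (rule eventually_sequentially_Suc[symmetric])
  have mem: "Suc n \<in> Suc ` A \<longleftrightarrow> n \<in> A" for n A
    by (rule inj_image_mem_iff) simp
  have eq: "eq_mod_fin A B \<longleftrightarrow> (\<forall>\<^sub>F n in cofinite. Suc n \<in> A \<longleftrightarrow> Suc n \<in> B)" for A B
    unfolding eq_mod_fin_alt by (rule cofin)
  have "shift (inf x y) = inf (shift x) (shift y)" for x y
    by transfer (simp add: eq mem)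
  moreover have "shift (sup x y) = sup (shift x) (shift y)" for x y
    by transfer (simp add: eq mem)
  moreover have "shift (- x) = - shift x" for x
    by transfer (simp add: eq mem)
  moreover have "shift bot = bot" "shift top = top"
    by (transfer, simp add: eq mem)+
  ultimately have "boolean_hom shift" by (simp add: boolean_hom_def)
  moreover have "x = y" if "shift x = shift y" for x y
  proof (use that in transfer)
    show "eq_mod_fin A B" if "eq_mod_fin (Suc ` A) (Suc ` B)" for A B
      using that unfolding eq[of "Suc ` A"] mem by (simp only: eq_mod_fin_alt)
  qed
  then have "inj shift" by (rule injI)
  moreover have "\<exists>x. y = shift x" for y
  proof -
    have "class_mod_fin B = shift (class_mod_fin {n. Suc n \<in> B})" for B
      by (simp add: shift.abs_eq pow_fin.abs_eq_iff eq mem)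
    then show ?thesis by (induct y rule: pow_fin.abs_induct) blast
  qed
  then have "surj shift" by (simp add: surj_def)
  ultimately show ?thesis by (simp add: dynamical_system_def bij_def)
qed


section \<open>Partitions\<close>

text \<open>
  The element \<open>bot\<close> is inserted because \<^const>\<open>Sup_fin\<close> is meaningful on nonempty finite sets only;
  it does not change the join.
\<close>

definition is_partition :: "'a::boolean_algebra set \<Rightarrow> bool" where
  "is_partition A \<longleftrightarrow>
     finite A \<and> bot \<notin> A \<and> pairwise (\<lambda>x y. inf x y = bot) A \<and> Sup_fin (insert bot A) = top"

definition refines_partition :: "'a::boolean_algebra set \<Rightarrow> 'a set \<Rightarrow> bool" where
  "refines_partition A' A \<longleftrightarrow> (\<forall>x\<in>A'. \<exists>y\<in>A. x \<le> y)"

definition natural_map :: "'a::boolean_algebra set \<Rightarrow> 'a \<Rightarrow> 'a" where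
  "natural_map A x = (THE y. y \<in> A \<and> x \<le> y)"


section \<open>Digraphs and epimorphisms\<close>

text \<open>
  A finite digraph, possibly with loops but without parallel arcs, is a \<^typ>\<open>'v pair_pre_digraph\<close>
  satisfying \<^const>\<open>pair_fin_digraph\<close>. Maps between digraphs matter only on the vertices, so
  equations between them are restricted to \<^const>\<open>pverts\<close>.
\<close>

definition partition_digraph ::
  "('a::boolean_algebra \<Rightarrow> 'a) \<Rightarrow> 'a set \<Rightarrow> 'a pair_pre_digraph" where
  "partition_digraph \<alpha> A =
     \<lparr>pverts = A, parcs = {(x, y). x \<in> A \<and> y \<in> A \<and> inf (\<alpha> x) y \<noteq> bot}\<rparr>"

definition epimorphism ::
  "('v \<Rightarrow> 'u) \<Rightarrow> 'v pair_pre_digraph \<Rightarrow> 'u pair_pre_digraph \<Rightarrow> bool" where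
  "epimorphism \<phi> V U \<longleftrightarrow>
     \<phi> ` pverts V = pverts U \<and>
     (\<forall>u\<in>pverts U. \<forall>u'\<in>pverts U. (u, u') \<in> parcs U \<longleftrightarrow>
        (\<exists>v\<in>pverts V. \<exists>v'\<in>pverts V. \<phi> v = u \<and> \<phi> v' = u' \<and> (v, v') \<in> parcs V))"

definition sc_digraph :: "'v pair_pre_digraph \<Rightarrow> bool" where
  "sc_digraph V \<longleftrightarrow> pair_fin_digraph V \<and> strongly_connected (with_proj V)"

text \<open>\<open>\<psi>\<close> is the vertex part of an isomorphism in the sense of \<^const>\<open>pre_digraph.digraph_isomorphism\<close>.\<close>

definition isomorphism_map ::
  "('v \<Rightarrow> 'u) \<Rightarrow> 'v pair_pre_digraph \<Rightarrow> 'u pair_pre_digraph \<Rightarrow> bool" where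
  "isomorphism_map \<psi> V U \<longleftrightarrow>
     (\<exists>f. pre_digraph.digraph_isomorphism (with_proj V) f \<and>
          with_proj U = app_iso f (with_proj V) \<and> iso_verts f = \<psi>)"

lemma isomorphism_map_iff:
  assumes "pair_wf_digraph V" "pair_wf_digraph U"
  shows "isomorphism_map \<psi> V U \<longleftrightarrow>
           bij_betw \<psi> (pverts V) (pverts U) \<and>
           (\<forall>v\<in>pverts V. \<forall>v'\<in>pverts V. (v, v') \<in> parcs V \<longleftrightarrow> (\<psi> v, \<psi> v') \<in> parcs U)"
    (is "?L \<longleftrightarrow> ?R")
proof
  have wfV: "wf_digraph (with_proj V)"
    using assms(1) by (auto simp: wf_digraph_def pair_wf_digraph_def)
  have inV: "fst e \<in> pverts V" "snd e \<in> pverts V" if "e \<in> parcs V" for e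
    using assms(1) that unfolding pair_wf_digraph_def by blast+
  have inU: "fst e \<in> pverts U" "snd e \<in> pverts U" if "e \<in> parcs U" for e
    using assms(2) that unfolding pair_wf_digraph_def by blast+
  {
    assume ?L
    then obtain f where
      f: "pre_digraph.digraph_isomorphism (with_proj V) f"
      and eq: "with_proj U = app_iso f (with_proj V)" and \<psi>: "iso_verts f = \<psi>"
      unfolding isomorphism_map_def by blast
    from eq have U: "pverts U = \<psi> ` pverts V" "parcs U = iso_arcs f ` parcs V"
      "iso_tail f = fst" "iso_head f = snd"
      using \<psi> by (auto simp: with_proj_def app_iso_def)
    have inj: "inj_on \<psi> (pverts V)"
      and ends: "\<And>e. e \<in> parcs V \<Longrightarrow> iso_arcs f e = (\<psi> (fst e), \<psi> (snd e))"
      using f \<psi> U unfolding pre_digraph.digraph_isomorphism_def by (auto simp: prod_eq_iff)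
    have "(v, v') \<in> parcs V \<longleftrightarrow> (\<psi> v, \<psi> v') \<in> parcs U"
      if v: "v \<in> pverts V" "v' \<in> pverts V" for v v'
    proof
      assume "(v, v') \<in> parcs V"
      then show "(\<psi> v, \<psi> v') \<in> parcs U"
        using ends[of "(v, v')"] U(2) by (metis fst_conv image_eqI snd_conv)
    next
      assume "(\<psi> v, \<psi> v') \<in> parcs U"
      then obtain e where e: "e \<in> parcs V" "(\<psi> v, \<psi> v') = (\<psi> (fst e), \<psi> (snd e))"
        using U(2) ends by auto
      then have "v = fst e" "v' = snd e"
        using v inj inV[OF e(1)] by (auto dest: inj_onD)
      then show "(v, v') \<in> parcs V" using e(1) by simp
    qed
    then show ?R using inj U(1) by (auto simp: bij_betw_def)
  }
  {
    assume R: ?R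
    define f where "f = \<lparr>iso_verts = \<psi>, iso_arcs = map_prod \<psi> \<psi>, iso_head = snd, iso_tail = fst\<rparr>"
    have inj: "inj_on \<psi> (pverts V)" and img: "\<psi> ` pverts V = pverts U"
      using R by (auto simp: bij_betw_def)
    have "inj_on (map_prod \<psi> \<psi>) (parcs V)"
      by (rule inj_on_subset[OF map_prod_inj_on[OF inj inj]]) (use inV in force)
    then have "pre_digraph.digraph_isomorphism (with_proj V) f"
      unfolding pre_digraph.digraph_isomorphism_def using wfV inj by (simp add: f_def)
    moreover have "map_prod \<psi> \<psi> ` parcs V = parcs U"
    proof (intro equalityI subsetI)
      fix e assume "e \<in> map_prod \<psi> \<psi> ` parcs V"
      then obtain v v' where e: "e = (\<psi> v, \<psi> v')" and v: "(v, v') \<in> parcs V" by auto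
      then have "v \<in> pverts V" "v' \<in> pverts V" using inV[OF v] by simp_all
      then show "e \<in> parcs U" using R e v by blast
    next
      fix e assume e: "e \<in> parcs U"
      then have "fst e \<in> \<psi> ` pverts V" "snd e \<in> \<psi> ` pverts V" using inU img by auto
      then obtain v v' where v: "v \<in> pverts V" "v' \<in> pverts V" "fst e = \<psi> v" "snd e = \<psi> v'"
        by blast
      then have *: "e = (\<psi> v, \<psi> v')" by (simp add: prod_eq_iff)
      then have "(v, v') \<in> parcs V" using R e v(1,2) by blast
      then show "e \<in> map_prod \<psi> \<psi> ` parcs V" using * by (auto simp: image_iff intro!: bexI)
    qed
    ultimately show ?L
      unfolding isomorphism_map_def
      by (intro exI[of _ f]) (auto simp: f_def app_iso_def with_proj_def img)
  }
qed

text \<open>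
  Here and in \<open>polarized\<close> below, quantification over all finite digraphs is expressed
  by quantification over the finite digraphs whose vertices are natural numbers. Every finite digraph
  is isomorphic to such a one, and all notions involved are invariant under isomorphism.
\<close>

definition compatible_epis ::
  "('u \<Rightarrow> 'a) \<Rightarrow> 'u pair_pre_digraph \<Rightarrow> ('v \<Rightarrow> 'a) \<Rightarrow> 'v pair_pre_digraph \<Rightarrow> bool" where
  "compatible_epis \<phi> U \<psi> V \<longleftrightarrow>
     (\<exists>(W :: nat pair_pre_digraph) \<phi>' \<psi>'.
        sc_digraph W \<and> epimorphism \<phi>' W U \<and> epimorphism \<psi>' W V \<and>
        (\<forall>w\<in>pverts W. \<phi> (\<phi>' w) = \<psi> (\<psi>' w)))"


section \<open>Virtual refinements and polarized systems\<close>

definition virtual_refinement ::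
  "('a::boolean_algebra \<Rightarrow> 'a) \<Rightarrow> 'a set \<Rightarrow> ('v \<Rightarrow> 'a) \<Rightarrow> 'v pair_pre_digraph \<Rightarrow> bool" where
  "virtual_refinement \<alpha> A \<phi> V \<longleftrightarrow> sc_digraph V \<and> epimorphism \<phi> V (partition_digraph \<alpha> A)"

definition realizes ::
  "('a::boolean_algebra \<Rightarrow> 'a) \<Rightarrow> 'a set \<Rightarrow> 'a set \<Rightarrow> ('v \<Rightarrow> 'a) \<Rightarrow> 'v pair_pre_digraph \<Rightarrow> bool" where
  "realizes \<alpha> A' A \<phi> V \<longleftrightarrow>
     refines_partition A' A \<and>
     (\<exists>\<psi>. isomorphism_map \<psi> V (partition_digraph \<alpha> A') \<and>
          (\<forall>v\<in>pverts V. natural_map A (\<psi> v) = \<phi> v))"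

definition polarized_refinement ::
  "('a::boolean_algebra \<Rightarrow> 'a) \<Rightarrow> 'a set \<Rightarrow> ('v \<Rightarrow> 'a) \<Rightarrow> 'v pair_pre_digraph \<Rightarrow> bool" where
  "polarized_refinement \<alpha> A \<phi> V \<longleftrightarrow>
     (\<exists>A'. is_partition A' \<and> realizes \<alpha> A' A \<phi> V) \<or>
     (\<exists>A'. is_partition A' \<and> refines_partition A' A \<and>
           \<not> compatible_epis \<phi> V (natural_map A) (partition_digraph \<alpha> A'))"

definition polarized :: "('a::boolean_algebra \<Rightarrow> 'a) \<Rightarrow> bool" where
  "polarized \<alpha> \<longleftrightarrow>
     (\<forall>A \<phi> (V :: nat pair_pre_digraph).
        is_partition A \<longrightarrow> virtual_refinement \<alpha> A \<phi> V \<longrightarrow> polarized_refinement \<alpha> A \<phi> V)"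

end

theory Submission
  imports Defs "HOL-Library.Ramsey"
begin

text \<open>
  Choose partitions \<open>A n\<close> of the first algebra and \<open>B n\<close> of the second, each sequence exhausting its
  algebra, with \<open>B n\<close> refining the image of \<open>A n\<close>. Incompressibility makes \<open>B n\<close> a virtual refinement
  of \<open>A n\<close>. It is compatible with every refinement of \<open>A n\<close>, as the common refinement inside the
  second algebra shows, so by polarization some partition of the first algebra realizes it. Through
  \<open>\<eta>\<close> the realization becomes a sequence \<open>f n\<close> of members of \<open>B n\<close> that eventually walks along arcs
  and lifts \<open>\<eta>\<close> on \<open>A n\<close>.

  The sequences for different \<open>n\<close> need not cohere. But among more than \<open>card (B i)\<close> sequences in
  \<open>B i\<close> some two agree at any given time, so by Ramsey's theorem one can pass to a subsequence of \<open>f\<close>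
  whose \<open>i\<close>-th and \<open>(i+1)\<close>-th terms agree infinitely often modulo \<open>B i\<close>. Switching from one to the
  next at such a time keeps the walk intact modulo \<open>B i\<close>, and the resulting diagonal walk \<open>g\<close> defines
  the extension by sending \<open>b\<close> to the class of \<open>{k. g k \<le> b}\<close>.
\<close>


section \<open>Partitions\<close>

lemma boolean_hom_mono:
  assumes "boolean_hom f" and "x \<le> y"
  shows "f x \<le> f y"
  using assms unfolding boolean_hom_def by (metis inf.absorb_iff1)

lemma boolean_hom_eq_bot_iff:
  assumes "boolean_hom f" and "inj f"
  shows "f x = bot \<longleftrightarrow> x = bot"
  using assms unfolding boolean_hom_def by (metis injD)

lemma inf_bot_iff_le_uminus:
  fixes x y :: "'a::boolean_algebra"
  shows "inf x y = bot \<longleftrightarrow> y \<le> - x"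
  by (metis inf_commute inf_shunt)

lemma meets_Sup_fin:
  fixes X :: "'a::boolean_algebra set"
  assumes "finite X" and "inf z (Sup_fin (insert bot X)) \<noteq> bot"
  shows "\<exists>x\<in>X. inf z x \<noteq> bot"
proof (rule ccontr)
  assume "\<not> ?thesis"
  then have "Sup_fin (insert bot X) \<le> - z"
    using assms(1) by (intro Sup_fin.boundedI) (auto simp: inf_bot_iff_le_uminus)
  then show False using assms(2) by (simp add: inf_bot_iff_le_uminus)
qed

text \<open>If every nonzero element meets a member, the join \<open>s\<close> of the members is
  \<open>top\<close>, because a nonzero \<open>- s\<close> would miss all of them. In this form,
  arguments about joins become searches for one member.\<close>

lemma is_partition_iff:
  "is_partition P \<longleftrightarrow>
     finite P \<and> bot \<notin> P \<and> (\<forall>x\<in>P. \<forall>y\<in>P. x \<noteq> y \<longrightarrow> inf x y = bot) \<and>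
     (\<forall>x. x \<noteq> bot \<longrightarrow> (\<exists>p\<in>P. inf x p \<noteq> bot))"
proof -
  have "Sup_fin (insert bot P) = top \<longleftrightarrow> (\<forall>x. x \<noteq> bot \<longrightarrow> (\<exists>p\<in>P. inf x p \<noteq> bot))"
    if fin: "finite P"
  proof
    assume "Sup_fin (insert bot P) = top"
    then show "\<forall>x. x \<noteq> bot \<longrightarrow> (\<exists>p\<in>P. inf x p \<noteq> bot)"
      using meets_Sup_fin[OF fin] by simp
  next
    assume *: "\<forall>x. x \<noteq> bot \<longrightarrow> (\<exists>p\<in>P. inf x p \<noteq> bot)"
    show "Sup_fin (insert bot P) = top"
    proof (rule ccontr)
      assume "Sup_fin (insert bot P) \<noteq> top"
      then have "- Sup_fin (insert bot P) \<noteq> bot"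
        by (metis boolean_algebra.compl_zero boolean_algebra_class.boolean_algebra.double_compl)
      then obtain p where p: "p \<in> P" "inf (- Sup_fin (insert bot P)) p \<noteq> bot" using * by blast
      then have "p \<le> Sup_fin (insert bot P)" using fin by (intro Sup_fin.coboundedI) auto
      then show False using p(2) by (simp add: inf_bot_iff_le_uminus)
    qed
  qed
  then show ?thesis unfolding is_partition_def pairwise_def by blast
qed

lemma partition_finite: "is_partition P \<Longrightarrow> finite P"
  by (simp add: is_partition_def)

lemma partition_meets: "is_partition P \<Longrightarrow> x \<noteq> bot \<Longrightarrow> \<exists>p\<in>P. inf x p \<noteq> bot"
  by (simp add: is_partition_iff)

lemma partition_unique:
  "is_partition P \<Longrightarrow> p \<in> P \<Longrightarrow> q \<in> P \<Longrightarrow> inf p q \<noteq> bot \<Longrightarrow> p = q"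
  unfolding is_partition_iff by blast

lemma partition_nonbot: "is_partition P \<Longrightarrow> p \<in> P \<Longrightarrow> p \<noteq> bot"
  unfolding is_partition_iff by blast

lemma inf_neq_bot_mono:
  fixes x y :: "'a::boolean_algebra"
  shows "inf x y \<noteq> bot \<Longrightarrow> x \<le> x' \<Longrightarrow> y \<le> y' \<Longrightarrow> inf x' y' \<noteq> bot"
  by (metis bot.extremum_uniqueI inf_mono)

lemma natural_map_eq:
  assumes "is_partition P" and "p \<in> P" and "x \<le> p" and "x \<noteq> bot"
  shows "natural_map P x = p"
  unfolding natural_map_def
proof (rule the_equality)
  fix q assume "q \<in> P \<and> x \<le> q"
  then show "q = p"
    using assms partition_unique[of P q p] inf_neq_bot_mono[of x x q p] by auto
qed (use assms in auto)

lemma partition_image: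
  assumes "boolean_hom f" and "inj f" and P: "is_partition P"
  shows "is_partition (f ` P)"
  unfolding is_partition_def
proof (intro conjI)
  have hom: "f (inf x y) = inf (f x) (f y)" "f (sup x y) = sup (f x) (f y)"
    "f bot = bot" "f top = top" for x y
    using assms(1) by (auto simp: boolean_hom_def)
  show "finite (f ` P)" using P by (simp add: is_partition_def)
  show "bot \<notin> f ` P"
    using P assms(1,2) by (auto simp: is_partition_def boolean_hom_eq_bot_iff image_iff dest: sym)
  show "pairwise (\<lambda>x y. inf x y = bot) (f ` P)"
    using P unfolding is_partition_iff pairwise_def by (metis (no_types, lifting) hom(1,3) imageE)
  have "f (Sup_fin (insert bot X)) = Sup_fin (insert bot (f ` X))" if "finite X" for X
    using that
  proof (induction X)
    case (insert x X)
    then have "Sup_fin (insert bot (insert x X)) = sup x (Sup_fin (insert bot X))"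
      "Sup_fin (insert bot (f ` insert x X)) = sup (f x) (Sup_fin (insert bot (f ` X)))"
      by (simp_all add: insert_commute[of bot])
    then show ?case using insert.IH by (simp only: hom)
  qed (simp add: hom)
  then show "Sup_fin (insert bot (f ` P)) = top"
    using P hom(4) by (metis is_partition_def)
qed

section \<open>Common refinements and decided elements\<close>

definition common_refinement :: "'a::boolean_algebra set \<Rightarrow> 'a set \<Rightarrow> 'a set" where
  "common_refinement P Q = (\<lambda>(p, q). inf p q) ` (P \<times> Q) - {bot}"

lemma is_partition_common_refinement:
  assumes "is_partition P" and "is_partition Q"
  shows "is_partition (common_refinement P Q)"
  unfolding is_partition_iff
proof (intro conjI ballI impI allI)
  show "finite (common_refinement P Q)"
    using assms by (simp add: common_refinement_def is_partition_def)
  show "bot \<notin> common_refinement P Q" by (simp add: common_refinement_def)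
next
  fix x y assume *: "x \<in> common_refinement P Q" "y \<in> common_refinement P Q" "x \<noteq> y"
  then obtain p q p' q' where pq: "x = inf p q" "y = inf p' q'" "p \<in> P" "p' \<in> P" "q \<in> Q" "q' \<in> Q"
    by (auto simp: common_refinement_def)
  then show "inf x y = bot"
    using * partition_unique[OF assms(1), of p p'] partition_unique[OF assms(2), of q q']
      inf_neq_bot_mono[of x y p p'] inf_neq_bot_mono[of x y q q'] by fastforce
next
  fix x :: 'a assume "x \<noteq> bot"
  then obtain p where p: "p \<in> P" "inf x p \<noteq> bot" using partition_meets[OF assms(1)] by blast
  then obtain q where q: "q \<in> Q" "inf (inf x p) q \<noteq> bot"
    using partition_meets[OF assms(2)] by blast
  then have "inf x (inf p q) \<noteq> bot" by (simp add: inf_assoc)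
  then show "\<exists>r\<in>common_refinement P Q. inf x r \<noteq> bot"
    using p q by (intro bexI[of _ "inf p q"]) (auto simp: common_refinement_def)
qed

lemma refines_common_refinement:
  "refines_partition (common_refinement P Q) P" "refines_partition (common_refinement P Q) Q"
  by (auto simp: refines_partition_def common_refinement_def intro: le_infI1 le_infI2)

lemma refines_partition_trans:
  "refines_partition P Q \<Longrightarrow> refines_partition Q R \<Longrightarrow> refines_partition P R"
  unfolding refines_partition_def by (meson order_trans)

text \<open>For a partition \<open>P\<close> this means that \<open>x\<close> belongs to the finite
  subalgebra whose atoms are the members of \<open>P\<close>.\<close>

definition decides :: "'a::boolean_algebra set \<Rightarrow> 'a \<Rightarrow> bool" where
  "decides P x \<longleftrightarrow> (\<forall>p\<in>P. p \<le> x \<or> p \<le> - x)"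

lemma decides_refines: "refines_partition P Q \<Longrightarrow> decides Q x \<Longrightarrow> decides P x"
  unfolding decides_def refines_partition_def by (meson order_trans)

lemma decidesD:
  assumes "is_partition P" and "decides P x" and "p \<in> P" and "inf p x \<noteq> bot"
  shows "p \<le> x"
  using assms unfolding decides_def by (metis inf_bot_iff_le_uminus inf_commute double_compl)

text \<open>Each stage cuts the previous partition along one more element. If \<open>a\<close>
  enumerates a countable algebra, the finite subalgebras generated by the stages exhaust it.\<close>

lemma deciding_partitions:
  fixes a :: "nat \<Rightarrow> 'a::boolean_algebra"
  obtains P where "\<And>n. is_partition (P n)" and "\<And>n. refines_partition (P (Suc n)) (P n)"
    and "\<And>n j. j < n \<Longrightarrow> decides (P n) (a j)"
proof -
  define Q where "Q x = {x, - x} - {bot}" for x :: 'a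
  have Q: "is_partition (Q x)" for x
    unfolding is_partition_iff Q_def
  proof (intro conjI allI impI)
    fix z :: 'a assume "z \<noteq> bot"
    then have "inf z x \<noteq> bot \<or> inf z (- x) \<noteq> bot"
      by (metis inf_bot_iff_le_uminus inf_commute inf_shunt double_compl inf.absorb1)
    then show "\<exists>p\<in>{x, - x} - {bot}. inf z p \<noteq> bot" by auto
  qed auto
  have dQ: "decides (Q x) x" for x by (auto simp: Q_def decides_def)
  define P where "P = rec_nat (Q top) (\<lambda>n P. common_refinement P (Q (a n)))"
  have P: "P 0 = Q top" "P (Suc n) = common_refinement (P n) (Q (a n))" for n
    by (simp_all add: P_def)
  show thesis
  proof
    show "is_partition (P n)" for n
      by (induction n) (auto simp: P Q intro: is_partition_common_refinement)
    show ref: "refines_partition (P (Suc n)) (P n)" for n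
      by (simp add: P refines_common_refinement)
    show "decides (P n) (a j)" if "j < n" for n j
      using that
    proof (induction n)
      case (Suc n)
      show ?case
      proof (cases "j = n")
        case True
        then show ?thesis
          using decides_refines[OF refines_common_refinement(2) dQ] by (simp add: P)
      next
        case False
        then show ?thesis using Suc decides_refines[OF ref] by simp
      qed
    qed simp
  qed
qed

text \<open>The join \<open>s\<close> of the members reachable from \<open>u\<close> satisfies
  \<open>\<alpha> s \<le> s\<close>, since a member that meets \<open>\<alpha> s\<close> meets the
  image of some reachable member and is then reachable itself. As \<open>s\<close> is nonzero,
  incompressibility forces \<open>s = top\<close>, so every member is reachable.\<close>

lemma partition_strongly_connected:
  assumes "dynamical_system \<alpha>" and "incompressible \<alpha>" and P: "is_partition P"
    and "u \<in> P" and "v \<in> P"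
  shows "(u, v) \<in> (parcs (partition_digraph \<alpha> P))\<^sup>*"
proof -
  let ?E = "parcs (partition_digraph \<alpha> P)"
  have hom: "boolean_hom \<alpha>" and bij: "bij \<alpha>" using assms(1) by (auto simp: dynamical_system_def)
  define X where "X = {x \<in> P. (u, x) \<in> ?E\<^sup>*}"
  define s where "s = Sup_fin (insert bot X)"
  have finX: "finite X" using partition_finite[OF P] by (simp add: X_def)
  have le_s: "x \<le> s" if "x \<in> X" for x
    unfolding s_def using finX that by (intro Sup_fin.coboundedI) auto
  have "\<alpha> s \<le> s"
  proof (rule ccontr)
    assume "\<not> \<alpha> s \<le> s"
    then have "inf (\<alpha> s) (- s) \<noteq> bot" by (simp add: inf_shunt)
    then obtain p where p: "p \<in> P" "inf (inf (\<alpha> s) (- s)) p \<noteq> bot"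
      using partition_meets[OF P] by blast
    have p1: "inf (\<alpha> s) p \<noteq> bot" by (rule inf_neq_bot_mono[OF p(2)]) simp_all
    have "inf (- s) p \<noteq> bot" by (rule inf_neq_bot_mono[OF p(2)]) simp_all
    then have p2: "\<not> p \<le> s" by (simp add: inf_bot_iff_le_uminus)
    obtain z where z: "p = \<alpha> z" using bij by (metis bij_pointE)
    have "inf z s \<noteq> bot"
      using p1 hom z by (metis boolean_hom_def inf_commute)
    then obtain x where x: "x \<in> X" "inf z x \<noteq> bot" using meets_Sup_fin[OF finX] s_def by blast
    then have "inf (\<alpha> x) p \<noteq> bot"
      using z hom bij by (metis bij_is_inj boolean_hom_def boolean_hom_eq_bot_iff inf_commute)
    then have "p \<in> X"
      using x(1) p(1) by (auto simp: X_def partition_digraph_def intro: rtrancl_into_rtrancl)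
    then show False using le_s p2 by blast
  qed
  moreover have "u \<in> X" using assms(4) by (simp add: X_def)
  then have "s \<noteq> bot" using le_s[of u] partition_nonbot[OF P assms(4)] by (metis bot.extremum_uniqueI)
  ultimately have "s = top" using assms(2) by (auto simp: incompressible_def)
  then have "inf v s \<noteq> bot" using partition_nonbot[OF P assms(5)] by simp
  then obtain x where "x \<in> X" "inf v x \<noteq> bot" using meets_Sup_fin[OF finX] s_def by blast
  then have "v \<in> X" using partition_unique[OF P assms(5), of x] by (auto simp: X_def)
  then show ?thesis by (simp add: X_def)
qed

lemma sc_digraphI:
  assumes "finite (pverts V)" and "pverts V \<noteq> {}" and "parcs V \<subseteq> pverts V \<times> pverts V"
    and "\<And>u v. u \<in> pverts V \<Longrightarrow> v \<in> pverts V \<Longrightarrow> (u, v) \<in> (parcs V)\<^sup>*"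
  shows "sc_digraph V"
proof -
  have fin: "finite (parcs V)" using assms(1,3) by (meson finite_SigmaI finite_subset)
  interpret pair_fin_digraph V
    by unfold_locales (use assms(1,3) fin in auto)
  have "u \<rightarrow>\<^sup>*\<^bsub>with_proj V\<^esub> v" if "u \<in> pverts V" "v \<in> pverts V" for u v
  proof -
    have "(u, v) \<in> (parcs V)\<^sup>*" using assms(4) that by blast
    then show ?thesis
    proof (induction rule: rtrancl_induct)
      case base
      then show ?case using that by simp
    next
      case (step y z)
      then show ?case by (simp add: reachable_adj_trans)
    qed
  qed
  then have "strongly_connected (with_proj V)" using assms(2) by (auto simp: strongly_connected_def)
  then show ?thesis using pair_fin_digraph_axioms by (simp add: sc_digraph_def)
qed


section \<open>Virtual refinements from extensions\<close>

text \<open>Serves for passing down along \<open>\<iota>\<close> and, with \<open>id\<close> as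
  embedding, for refinements within one algebra. Arcs lift because a nonzero
  \<open>inf (\<beta> (\<iota> a)) (\<iota> a')\<close> can be cut by \<open>B\<close> at both
  ends.\<close>

lemma epimorphism_partition:
  fixes \<alpha> :: "'a::boolean_algebra \<Rightarrow> 'a" and \<beta> :: "'b::boolean_algebra \<Rightarrow> 'b"
  assumes "dynamical_system \<beta>" and "embedding \<alpha> \<beta> \<iota>"
    and A: "is_partition A" and B: "is_partition B"
    and \<phi>: "\<And>b. b \<in> B \<Longrightarrow> \<phi> b \<in> A" "\<And>b. b \<in> B \<Longrightarrow> b \<le> \<iota> (\<phi> b)"
  shows "epimorphism \<phi> (partition_digraph \<beta> B) (partition_digraph \<alpha> A)"
proof -
  have hom: "boolean_hom \<beta>" and bij: "bij \<beta>" using assms(1) by (auto simp: dynamical_system_def)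
  have \<iota>: "boolean_hom \<iota>" "inj \<iota>" and comm: "\<iota> (\<alpha> x) = \<beta> (\<iota> x)" for x
    using assms(2) by (auto simp: embedding_def fun_eq_iff)
  have inf_\<iota>: "inf (\<iota> x) (\<iota> y) = bot \<longleftrightarrow> inf x y = bot" for x y
    using \<iota> boolean_hom_eq_bot_iff by (metis boolean_hom_def)
  have inf_\<beta>: "inf (\<beta> x) (\<beta> y) = bot \<longleftrightarrow> inf x y = bot" for x y
    using hom bij boolean_hom_eq_bot_iff by (metis bij_is_inj boolean_hom_def)
  \<comment> \<open>A member of \<open>B\<close> lies under the image of just one member of
    \<open>A\<close>, so \<open>\<phi> b\<close> can be recognized from any \<open>\<iota> a\<close>
    that \<open>b\<close> meets.\<close>
  have \<phi>_eq: "\<phi> b = a" if "b \<in> B" "a \<in> A" "inf b (\<iota> a) \<noteq> bot" for a b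
  proof (rule partition_unique[OF A \<phi>(1)[OF that(1)] that(2)])
    have "inf (\<iota> (\<phi> b)) (\<iota> a) \<noteq> bot"
      by (rule inf_neq_bot_mono[OF that(3)]) (use \<phi>(2) that(1) in auto)
    then show "inf (\<phi> b) a \<noteq> bot" by (simp add: inf_\<iota>)
  qed
  have "\<phi> ` B = A"
  proof (intro equalityI subsetI)
    fix a assume a: "a \<in> A"
    then have "\<iota> a \<noteq> bot" using partition_nonbot[OF A] \<iota> by (simp add: boolean_hom_eq_bot_iff)
    then obtain b where "b \<in> B" "inf (\<iota> a) b \<noteq> bot" using partition_meets[OF B] by blast
    then show "a \<in> \<phi> ` B" using \<phi>_eq[of b a] a by (auto simp: inf_commute)
  qed (use \<phi> in auto)
  moreover have "inf (\<alpha> a) a' \<noteq> bot \<longleftrightarrow>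
      (\<exists>b\<in>B. \<exists>b'\<in>B. \<phi> b = a \<and> \<phi> b' = a' \<and> inf (\<beta> b) b' \<noteq> bot)"
    if a: "a \<in> A" "a' \<in> A" for a a'
  proof
    assume "inf (\<alpha> a) a' \<noteq> bot"
    then have "inf (\<beta> (\<iota> a)) (\<iota> a') \<noteq> bot" by (simp flip: comm add: inf_\<iota>)
    \<comment> \<open>The head of the arc is chosen first; pulling it back along
      \<open>\<beta>\<close> leaves a nonzero piece of \<open>\<iota> a\<close> from which to choose
      the tail.\<close>
    then obtain b' where b': "b' \<in> B" "inf (inf (\<beta> (\<iota> a)) (\<iota> a')) b' \<noteq> bot"
      using partition_meets[OF B] by blast
    have "inf (\<iota> a') b' \<noteq> bot" by (rule inf_neq_bot_mono[OF b'(2)]) simp_all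
    then have \<phi>b': "\<phi> b' = a'" using \<phi>_eq b'(1) a by (simp add: inf_commute)
    have "inf (\<beta> (\<iota> a)) b' \<noteq> bot" by (rule inf_neq_bot_mono[OF b'(2)]) simp_all
    moreover obtain z where z: "b' = \<beta> z" using bij by (metis bij_pointE)
    ultimately have "inf (\<iota> a) z \<noteq> bot" by (simp add: inf_\<beta>)
    then obtain b where b: "b \<in> B" "inf (inf (\<iota> a) z) b \<noteq> bot"
      using partition_meets[OF B] by blast
    have "inf b (\<iota> a) \<noteq> bot" by (rule inf_neq_bot_mono[of b "inf (\<iota> a) z"]) (use b(2) in \<open>simp_all add: inf_commute\<close>)
    then have \<phi>b: "\<phi> b = a" using \<phi>_eq b(1) a by simp
    have "inf b z \<noteq> bot" by (rule inf_neq_bot_mono[of b "inf (\<iota> a) z"]) (use b(2) in \<open>simp_all add: inf_commute\<close>)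
    then have "inf (\<beta> b) b' \<noteq> bot" by (simp add: z inf_\<beta>)
    then show "\<exists>b\<in>B. \<exists>b'\<in>B. \<phi> b = a \<and> \<phi> b' = a' \<and> inf (\<beta> b) b' \<noteq> bot"
      using \<phi>b \<phi>b' b(1) b'(1) by blast
  next
    assume "\<exists>b\<in>B. \<exists>b'\<in>B. \<phi> b = a \<and> \<phi> b' = a' \<and> inf (\<beta> b) b' \<noteq> bot"
    then obtain b b' where b: "b \<in> B" "b' \<in> B" "\<phi> b = a" "\<phi> b' = a'" "inf (\<beta> b) b' \<noteq> bot"
      by blast
    then have "inf (\<beta> (\<iota> a)) (\<iota> a') \<noteq> bot"
      using \<phi>(2) boolean_hom_mono[OF hom] by (intro inf_neq_bot_mono[OF b(5)]) auto
    then show "inf (\<alpha> a) a' \<noteq> bot" by (simp flip: comm add: inf_\<iota>)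
  qed
  ultimately show ?thesis by (simp add: epimorphism_def partition_digraph_def)
qed

text \<open>Copying along an injection into the naturals supplies the vertex type that
  \<open>polarized\<close> and \<open>compatible_epis\<close> quantify over.\<close>

definition image_digraph :: "('u \<Rightarrow> 'v) \<Rightarrow> 'u pair_pre_digraph \<Rightarrow> 'v pair_pre_digraph" where
  "image_digraph g D = \<lparr>pverts = g ` pverts D, parcs = map_prod g g ` parcs D\<rparr>"

lemma image_digraph_simps [simp]:
  "pverts (image_digraph g D) = g ` pverts D"
  "parcs (image_digraph g D) = map_prod g g ` parcs D"
  by (simp_all add: image_digraph_def)

lemma image_digraph_arc_iff [simp]:
  "inj g \<Longrightarrow> (g u, g v) \<in> parcs (image_digraph g D) \<longleftrightarrow> (u, v) \<in> parcs D"
  by (auto simp: inj_eq)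

lemma epimorphism_image_source:
  assumes "inj g" and "epimorphism \<phi> V U"
  shows "epimorphism (\<phi> \<circ> inv g) (image_digraph g V) U"
  using assms(2) unfolding epimorphism_def
  by (simp add: image_comp o_def assms(1) inv_f_f image_digraph_arc_iff[OF assms(1)]
      del: image_digraph_simps(2))

lemma epimorphism_image_target:
  assumes "inj g" and "epimorphism \<phi> V U"
  shows "epimorphism (g \<circ> \<phi>) V (image_digraph g U)"
proof -
  have "(g \<circ> \<phi>) ` pverts V = g ` pverts U"
    using assms(2) unfolding epimorphism_def image_comp[symmetric] by simp
  then show ?thesis
    using assms(2) unfolding epimorphism_def
    by (simp add: inj_eq[OF assms(1)] image_digraph_arc_iff[OF assms(1)]
        del: image_digraph_simps(2))
qed

lemma sc_digraph_image_partition: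
  assumes "dynamical_system \<alpha>" and "incompressible \<alpha>" and "is_partition P" and "P \<noteq> {}"
  shows "sc_digraph (image_digraph g (partition_digraph \<alpha> P))"
proof (rule sc_digraphI)
  fix u v
  assume "u \<in> pverts (image_digraph g (partition_digraph \<alpha> P))"
    and "v \<in> pverts (image_digraph g (partition_digraph \<alpha> P))"
  then obtain x y where xy: "u = g x" "v = g y" "x \<in> P" "y \<in> P"
    by (auto simp: partition_digraph_def)
  have "(x, y) \<in> (parcs (partition_digraph \<alpha> P))\<^sup>*"
    using partition_strongly_connected assms xy by blast
  then show "(u, v) \<in> (parcs (image_digraph g (partition_digraph \<alpha> P)))\<^sup>*"
    unfolding xy(1,2)
  proof induction
    case (step y z)
    then have "(g y, g z) \<in> parcs (image_digraph g (partition_digraph \<alpha> P))" by force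
    with step.IH show ?case by (rule rtrancl_into_rtrancl)
  qed simp
qed (use assms in \<open>auto simp: partition_digraph_def is_partition_def\<close>)

section \<open>Realizing an extension by polarization\<close>

lemma partition_nonempty:
  assumes "is_partition P" and "(bot :: 'a::boolean_algebra) \<noteq> top"
  shows "P \<noteq> ({} :: 'a set)"
  using partition_meets[OF assms(1), of top] assms(2) by auto

lemma natural_map_refines:
  assumes "is_partition P" and "is_partition Q" and "refines_partition Q P" and "x \<in> Q"
  shows "natural_map P x \<in> P" and "x \<le> natural_map P x"
proof -
  obtain p where "p \<in> P" "x \<le> p" using assms(3,4) unfolding refines_partition_def by blast
  moreover from this have "natural_map P x = p"
    using natural_map_eq assms(1) partition_nonbot[OF assms(2,4)] by blast
  ultimately show "natural_map P x \<in> P" and "x \<le> natural_map P x" by simp_all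
qed

text \<open>Polarization offers a realization or an incompatible refinement \<open>A'\<close> of
  \<open>A\<close>. The second is impossible: the common refinement of \<open>B\<close> and the
  image of \<open>A'\<close> maps onto both compatibly, and it is strongly connected because
  \<open>\<beta>\<close> is incompressible.\<close>

lemma polarized_realization:
  fixes \<alpha> :: "'a::boolean_algebra \<Rightarrow> 'a" and \<beta> :: "'b::boolean_algebra \<Rightarrow> 'b"
  assumes "countable (UNIV :: 'b set)" and \<beta>: "dynamical_system \<beta>" "incompressible \<beta>"
    and \<iota>: "embedding \<alpha> \<beta> \<iota>" and "polarized \<alpha>" and "(bot :: 'b) \<noteq> top"
    and A: "is_partition A" and B: "is_partition B" and ref: "refines_partition B (\<iota> ` A)"
  obtains \<psi> A' where "is_partition A'" and "\<psi> ` B = A'"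
    and "\<And>x y. x \<in> B \<Longrightarrow> y \<in> B \<Longrightarrow> inf (\<beta> x) y = bot \<Longrightarrow> inf (\<alpha> (\<psi> x)) (\<psi> y) = bot"
    and "inj_on \<psi> B"
    and "\<And>x a. x \<in> B \<Longrightarrow> a \<in> A \<Longrightarrow> x \<le> \<iota> a \<Longrightarrow> \<psi> x \<le> a"
proof -
  have \<iota>_hom: "boolean_hom \<iota>" "inj \<iota>" using \<iota> by (auto simp: embedding_def)
  obtain g :: "'b \<Rightarrow> nat" where g: "inj g"
    using assms(1) by (auto simp: countable_def)
  have inv_g [simp]: "inv g (g x) = x" for x using g by simp
  \<comment> \<open>The counterpart of \<open>natural_map\<close> across \<open>\<iota>\<close>. The
    choice is meaningful when \<open>x\<close> lies under some \<open>\<iota> a\<close> with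
    \<open>a\<close> in \<open>C\<close>, and unique when moreover \<open>C\<close> is a partition
    and \<open>x\<close> is nonzero.\<close>
  define below where "below C x = (SOME a. a \<in> C \<and> x \<le> \<iota> a)" for C x
  have below: "below C x \<in> C" "x \<le> \<iota> (below C x)" if "a \<in> C" "x \<le> \<iota> a" for C x a
    using someI[of "\<lambda>a. a \<in> C \<and> x \<le> \<iota> a" a] that by (auto simp: below_def)
  have below_eq: "a = b"
    if "is_partition C" "a \<in> C" "x \<le> \<iota> a" "b \<in> C" "x \<le> \<iota> b" "x \<noteq> bot" for C x a b
  proof (rule partition_unique[OF that(1,2,4)])
    have "inf (\<iota> a) (\<iota> b) \<noteq> bot" by (rule inf_neq_bot_mono[of x x]) (use that in auto)
    then show "inf a b \<noteq> bot" using \<iota>_hom by (metis boolean_hom_def)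
  qed
  let ?U = "partition_digraph \<alpha> A" and ?V = "image_digraph g (partition_digraph \<beta> B)"
  define \<phi> where "\<phi> = below A \<circ> inv g"
  have below_B: "below A b \<in> A" "b \<le> \<iota> (below A b)" if "b \<in> B" for b
    using ref that below[of _ A b] by (auto simp: refines_partition_def)
  have "virtual_refinement \<alpha> A \<phi> ?V"
    unfolding virtual_refinement_def \<phi>_def
    using sc_digraph_image_partition[OF \<beta> B partition_nonempty[OF B assms(6)]]
      epimorphism_image_source[OF g epimorphism_partition[OF \<beta>(1) \<iota> A B below_B]]
    by blast
  then have pol: "polarized_refinement \<alpha> A \<phi> ?V"
    using assms(5) A by (simp add: polarized_def)
  have "compatible_epis \<phi> ?V (natural_map A) (partition_digraph \<alpha> A')"
    if A': "is_partition A'" "refines_partition A' A" for A'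
  proof -
    define C where "C = common_refinement B (\<iota> ` A')"
    have C: "is_partition C"
      unfolding C_def by (intro is_partition_common_refinement B partition_image \<iota>_hom A'(1))
    have C_ref: "refines_partition C B" "refines_partition C (\<iota> ` A')"
      by (simp_all add: C_def refines_common_refinement)
    have below_C: "below A' c \<in> A'" "c \<le> \<iota> (below A' c)" if "c \<in> C" for c
      using C_ref(2) that below[of _ A' c] by (auto simp: refines_partition_def)
    have nat_C: "natural_map B c \<in> B" "c \<le> id (natural_map B c)" if "c \<in> C" for c
      using natural_map_refines[OF B C C_ref(1) that] by simp_all
    have nat_A': "natural_map A a \<in> A" "a \<le> natural_map A a" if "a \<in> A'" for a
      using natural_map_refines[OF A A' that] by simp_all
    have id_emb: "embedding \<beta> \<beta> id" by (simp add: embedding_def boolean_hom_def)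
    let ?W = "image_digraph g (partition_digraph \<beta> C)"
    have "sc_digraph ?W"
      using sc_digraph_image_partition[OF \<beta> C partition_nonempty[OF C assms(6)]] .
    moreover have "epimorphism ((g \<circ> natural_map B) \<circ> inv g) ?W ?V"
      by (intro epimorphism_image_source g epimorphism_image_target
          epimorphism_partition[OF \<beta>(1) id_emb B C] nat_C)
    moreover have "epimorphism (below A' \<circ> inv g) ?W (partition_digraph \<alpha> A')"
      by (intro epimorphism_image_source g epimorphism_partition[OF \<beta>(1) \<iota> A'(1) C] below_C)
    \<comment> \<open>Both composites send \<open>c\<close> to the member of \<open>A\<close> whose
      image lies above \<open>c\<close>, which is unique by \<open>below_eq\<close>.\<close>
    moreover have "below A (natural_map B c) = natural_map A (below A' c)" if c: "c \<in> C" for c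
    proof (rule below_eq[OF A, of _ c])
      show "c \<le> \<iota> (below A (natural_map B c))"
        using nat_C[OF c] below_B(2) order_trans by fastforce
      show "c \<le> \<iota> (natural_map A (below A' c))"
        using below_C[OF c] nat_A' boolean_hom_mono[OF \<iota>_hom(1)] order_trans by blast
    qed (use c nat_C below_B below_C nat_A' partition_nonbot[OF C] in auto)
    then have "\<forall>w\<in>pverts ?W.
        \<phi> (((g \<circ> natural_map B) \<circ> inv g) w) = natural_map A ((below A' \<circ> inv g) w)"
      by (simp add: \<phi>_def partition_digraph_def)
    ultimately show ?thesis
      unfolding compatible_epis_def by blast
  qed
  then obtain A' where A': "is_partition A'" and real: "realizes \<alpha> A' A \<phi> ?V"
    using pol by (auto simp: polarized_refinement_def)
  obtain \<psi> where \<psi>: "isomorphism_map \<psi> ?V (partition_digraph \<alpha> A')"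
    "\<forall>v\<in>pverts ?V. natural_map A (\<psi> v) = \<phi> v" and ref': "refines_partition A' A"
    using real by (auto simp: realizes_def)
  have V: "pverts ?V = g ` B" "pverts (partition_digraph \<alpha> A') = A'"
    by (simp_all add: partition_digraph_def)
  have "pair_wf_digraph ?V" "pair_wf_digraph (partition_digraph \<alpha> A')"
    by (auto simp: pair_wf_digraph_def partition_digraph_def)
  then have bij: "bij_betw \<psi> (g ` B) A'"
    and arcs: "\<forall>v\<in>g ` B. \<forall>v'\<in>g ` B.
      (v, v') \<in> parcs ?V \<longleftrightarrow> (\<psi> v, \<psi> v') \<in> parcs (partition_digraph \<alpha> A')"
    using \<psi>(1) isomorphism_map_iff[of ?V "partition_digraph \<alpha> A'" \<psi>]
    unfolding V by simp_all
  have "bij_betw g B (g ` B)" using g by (auto simp: bij_betw_def intro: inj_on_subset)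
  then have bij': "bij_betw (\<psi> \<circ> g) B A'" using bij by (rule bij_betw_trans)
  show thesis
  proof
    show "is_partition A'" by (rule A')
    show im: "(\<psi> \<circ> g) ` B = A'" and "inj_on (\<psi> \<circ> g) B"
      using bij' by (auto simp: bij_betw_def)
    \<comment> \<open>Absent arcs pass from \<open>B\<close> to \<open>A'\<close>, so a walk in
      \<open>A'\<close> can later be read as a walk in \<open>B\<close>.\<close>
    show "inf (\<alpha> ((\<psi> \<circ> g) x)) ((\<psi> \<circ> g) y) = bot" if "x \<in> B" "y \<in> B" "inf (\<beta> x) y = bot" for x y
    proof -
      have "(x, y) \<notin> parcs (partition_digraph \<beta> B)" using that by (simp add: partition_digraph_def)
      then have "(g x, g y) \<notin> parcs ?V" by (simp only: image_digraph_arc_iff[OF g] not_False_eq_True)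
      then have "(\<psi> (g x), \<psi> (g y)) \<notin> parcs (partition_digraph \<alpha> A')"
        using arcs that(1,2) by blast
      moreover have "\<psi> (g x) \<in> A'" "\<psi> (g y) \<in> A'" using im that(1,2) by auto
      ultimately show ?thesis by (simp add: partition_digraph_def)
    qed
    show "(\<psi> \<circ> g) x \<le> a" if x: "x \<in> B" and a: "a \<in> A" "x \<le> \<iota> a" for x a
    proof -
      have "below A x = a"
        using below_eq[OF A below_B[OF x] a] partition_nonbot[OF B x] .
      moreover have "natural_map A (\<psi> (g x)) = below A x"
        using \<psi>(2) x by (simp add: \<phi>_def partition_digraph_def)
      moreover have "\<psi> (g x) \<le> natural_map A (\<psi> (g x))"
        by (rule natural_map_refines[OF A A' ref']) (use im x in auto)
      ultimately show ?thesis by simp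
    qed
  qed
qed


section \<open>Itineraries of embeddings into the shift\<close>

lemma class_rep_pow_fin [simp]: "class_mod_fin (rep_pow_fin x) = x"
  by (metis Quotient3_abs_rep Quotient3_pow_fin)

lemma eq_mod_fin_rep: "eq_mod_fin (rep_pow_fin (class_mod_fin S)) S"
  by (simp flip: pow_fin.abs_eq_iff)

text \<open>\<open>rep_pow_fin\<close> chooses representatives independently of one another, so
  relations between classes hold for the chosen sets only from some index on.\<close>

lemma eventually_rep_class:
  "\<forall>\<^sub>F k in sequentially. k \<in> rep_pow_fin (class_mod_fin S) \<longleftrightarrow> k \<in> S"
  using eq_mod_fin_rep[of S] by (simp add: eq_mod_fin_alt cofinite_eq_sequentially)

lemma eventually_rep_inf:
  "\<forall>\<^sub>F k in sequentially. k \<in> rep_pow_fin (inf x y) \<longleftrightarrow> k \<in> rep_pow_fin x \<and> k \<in> rep_pow_fin y"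
  using eventually_rep_class[of "rep_pow_fin x \<inter> rep_pow_fin y"]
  by (simp flip: inf_pow_fin.abs_eq)

lemma eventually_rep_bot: "\<forall>\<^sub>F k in sequentially. k \<notin> rep_pow_fin bot"
  using eventually_rep_class[of "{}"] by (simp add: bot_pow_fin.abs_eq)

lemma eventually_rep_shift:
  "\<forall>\<^sub>F k in sequentially. Suc k \<in> rep_pow_fin (shift x) \<longleftrightarrow> k \<in> rep_pow_fin x"
proof -
  have "\<forall>\<^sub>F k in sequentially. k \<in> rep_pow_fin (shift x) \<longleftrightarrow> k \<in> Suc ` rep_pow_fin x"
    using eventually_rep_class[of "Suc ` rep_pow_fin x"] by (simp flip: shift.abs_eq)
  then have "\<forall>\<^sub>F k in sequentially. Suc k \<in> rep_pow_fin (shift x) \<longleftrightarrow> Suc k \<in> Suc ` rep_pow_fin x"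
    by (subst eventually_sequentially_Suc)
  then show ?thesis by (auto elim: eventually_mono)
qed

lemma eventually_rep_disjoint:
  assumes "inf x y = bot"
  shows "\<forall>\<^sub>F k in sequentially. \<not> (k \<in> rep_pow_fin x \<and> k \<in> rep_pow_fin y)"
  using eventually_rep_inf[of x y] eventually_rep_bot unfolding assms
  by eventually_elim simp

lemma class_mod_fin_eq_iff:
  "class_mod_fin S = class_mod_fin T \<longleftrightarrow> (\<forall>\<^sub>F k in sequentially. k \<in> S \<longleftrightarrow> k \<in> T)"
  by (simp add: pow_fin.abs_eq_iff eq_mod_fin_alt cofinite_eq_sequentially)

lemma frequently_rep:
  assumes "x \<noteq> bot"
  shows "\<exists>\<^sub>F k in sequentially. k \<in> rep_pow_fin x"
proof (rule ccontr)
  assume "\<not> ?thesis"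
  then have "class_mod_fin (rep_pow_fin x) = class_mod_fin {}"
    unfolding class_mod_fin_eq_iff by (simp add: not_frequently)
  then show False using assms by (simp add: bot_pow_fin.abs_eq)
qed

text \<open>If infinitely many indices were uncovered, the class of their set would be nonzero and
  meet some member \<open>p\<close>, whose representative would then contain uncovered
  indices.\<close>

lemma eventually_partition_covers:
  assumes "is_partition P"
  shows "\<forall>\<^sub>F k in sequentially. \<exists>p\<in>P. k \<in> rep_pow_fin p"
proof (rule ccontr)
  assume not: "\<not> ?thesis"
  define S where "S = {k. \<forall>p\<in>P. k \<notin> rep_pow_fin p}"
  have "class_mod_fin S \<noteq> bot"
    using not by (auto simp: bot_pow_fin.abs_eq class_mod_fin_eq_iff S_def not_eventually)
  then obtain p where p: "p \<in> P" "inf (class_mod_fin S) p \<noteq> bot"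
    using partition_meets[OF assms] by blast
  then have "\<exists>\<^sub>F k in sequentially. k \<in> rep_pow_fin (inf (class_mod_fin S) p)"
    by (intro frequently_rep)
  then have "\<exists>\<^sub>F k in sequentially. False"
    by (rule frequently_rev_mp)
      (use eventually_rep_inf[of "class_mod_fin S" p] eventually_rep_class[of S] in
        \<open>eventually_elim, use p(1) in \<open>auto simp: S_def\<close>\<close>)
  then show False by simp
qed

text \<open>The sets representing the images of the members of \<open>P\<close> eventually partition
  the indices, and \<open>f k\<close> records which one contains \<open>k\<close>. The bijection
  \<open>\<psi>\<close> labels this record by \<open>B\<close>.\<close>

lemma embedding_shift_itinerary:
  fixes \<psi> :: "'b \<Rightarrow> 'a::boolean_algebra"
  assumes "embedding \<alpha> shift \<eta>" and P: "is_partition P" and \<psi>: "bij_betw \<psi> B P" and "B \<noteq> {}"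
  obtains f :: "nat \<Rightarrow> 'b" where "\<And>k. f k \<in> B"
    and "\<And>x. x \<in> B \<Longrightarrow> \<exists>\<^sub>F k in sequentially. f k = x"
    and "\<forall>\<^sub>F k in sequentially. inf (\<alpha> (\<psi> (f k))) (\<psi> (f (Suc k))) \<noteq> bot"
    and "\<And>a. decides P a \<Longrightarrow>
      \<forall>\<^sub>F k in sequentially. k \<in> rep_pow_fin (\<eta> a) \<longleftrightarrow> \<psi> (f k) \<le> a"
proof -
  have \<eta>: "boolean_hom \<eta>" "inj \<eta>" and comm: "\<eta> (\<alpha> x) = shift (\<eta> x)" for x
    using assms(1) by (auto simp: embedding_def fun_eq_iff)
  have \<eta>_disj: "inf (\<eta> x) (\<eta> y) = bot" if "inf x y = bot" for x y
    using \<eta> that by (metis boolean_hom_def)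
  have inj: "inj_on \<psi> B" and im: "\<psi> ` B = P" using \<psi> by (auto simp: bij_betw_def)
  have fin: "finite B" using bij_betw_finite[OF \<psi>] partition_finite[OF P] by simp
  define R where "R x = rep_pow_fin (\<eta> (\<psi> x))" for x
  \<comment> \<open>For the finitely many \<open>k\<close> that lie in no \<open>R x\<close> an
    arbitrary member of \<open>B\<close> is taken, so that membership in \<open>B\<close> holds at
    every index.\<close>
  define f where "f k = (if \<exists>x\<in>B. k \<in> R x then SOME x. x \<in> B \<and> k \<in> R x else SOME x. x \<in> B)" for k
  have fB: "f k \<in> B" for k
  proof (cases "\<exists>x\<in>B. k \<in> R x")
    case True
    then show ?thesis using someI_ex[of "\<lambda>x. x \<in> B \<and> k \<in> R x"] by (auto simp: f_def)
  next
    case False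
    then show ?thesis using assms(4) by (simp add: f_def some_in_eq)
  qed
  have "\<forall>\<^sub>F k in sequentially. \<exists>x\<in>B. k \<in> R x"
    using eventually_partition_covers[OF partition_image[OF \<eta> P]] by (simp add: R_def flip: im)
  then have fR: "\<forall>\<^sub>F k in sequentially. k \<in> R (f k)"
  proof eventually_elim
    case (elim k)
    then show ?case using someI_ex[of "\<lambda>x. x \<in> B \<and> k \<in> R x"] by (auto simp: f_def)
  qed
  have uniq: "\<forall>\<^sub>F k in sequentially. \<forall>x\<in>B. k \<in> R x \<longleftrightarrow> f k = x"
  proof -
    have "\<forall>\<^sub>F k in sequentially. \<forall>x\<in>B. \<forall>y\<in>B. k \<in> R x \<longrightarrow> k \<in> R y \<longrightarrow> x = y"
    proof (intro eventually_ball_finite fin ballI)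
      fix x y assume xy: "x \<in> B" "y \<in> B"
      show "\<forall>\<^sub>F k in sequentially. k \<in> R x \<longrightarrow> k \<in> R y \<longrightarrow> x = y"
      proof (cases "x = y")
        case False
        then have "inf (\<psi> x) (\<psi> y) = bot"
          using xy inj im partition_unique[OF P, of "\<psi> x" "\<psi> y"] by (auto dest: inj_onD)
        from eventually_rep_disjoint[OF \<eta>_disj[OF this]] show ?thesis
          by eventually_elim (simp add: R_def)
      qed simp
    qed
    then show ?thesis using fR by eventually_elim (use fB in blast)
  qed
  show thesis
  proof
    show "f k \<in> B" for k by (rule fB)
    show "\<exists>\<^sub>F k in sequentially. f k = x" if x: "x \<in> B" for x
    proof -
      have "\<eta> (\<psi> x) \<noteq> bot"
        using x im partition_nonbot[OF P] by (auto simp: boolean_hom_eq_bot_iff[OF \<eta>])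
      from frequently_rep[OF this] show ?thesis
        by (rule frequently_rev_mp) (use uniq in \<open>eventually_elim, use x in \<open>auto simp: R_def\<close>\<close>)
    qed
    have "\<forall>\<^sub>F k in sequentially. \<forall>x\<in>B. \<forall>y\<in>B. k \<in> R x \<longrightarrow> Suc k \<in> R y \<longrightarrow> inf (\<alpha> (\<psi> x)) (\<psi> y) \<noteq> bot"
    proof (intro eventually_ball_finite fin ballI)
      fix x y assume xy: "x \<in> B" "y \<in> B"
      show "\<forall>\<^sub>F k in sequentially. k \<in> R x \<longrightarrow> Suc k \<in> R y \<longrightarrow> inf (\<alpha> (\<psi> x)) (\<psi> y) \<noteq> bot"
      proof (cases "inf (\<alpha> (\<psi> x)) (\<psi> y) = bot")
        \<comment> \<open>Without an arc, \<open>shift (\<eta> (\<psi> x))\<close> is disjoint from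
          \<open>\<eta> (\<psi> y)\<close>, and for all large \<open>k\<close> in \<open>R x\<close>
          the index \<open>Suc k\<close> belongs to the representative of the former.\<close>
        case True
        have "\<forall>\<^sub>F k in sequentially.
          \<not> (Suc k \<in> rep_pow_fin (shift (\<eta> (\<psi> x))) \<and> Suc k \<in> rep_pow_fin (\<eta> (\<psi> y)))"
          using eventually_rep_disjoint[OF \<eta>_disj[OF True]]
          by (subst eventually_sequentially_Suc) (simp add: comm)
        then show ?thesis using eventually_rep_shift[of "\<eta> (\<psi> x)"]
          by eventually_elim (auto simp: R_def)
      qed simp
    qed
    moreover have "\<forall>\<^sub>F k in sequentially. Suc k \<in> R (f (Suc k))"
      using fR by (subst eventually_sequentially_Suc)
    ultimately show "\<forall>\<^sub>F k in sequentially. inf (\<alpha> (\<psi> (f k))) (\<psi> (f (Suc k))) \<noteq> bot"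
      using fR by eventually_elim (use fB in blast)
    show "\<forall>\<^sub>F k in sequentially. k \<in> rep_pow_fin (\<eta> a) \<longleftrightarrow> \<psi> (f k) \<le> a" if a: "decides P a" for a
    proof -
      have "\<forall>\<^sub>F k in sequentially. \<forall>x\<in>B. k \<in> R x \<longrightarrow> (k \<in> rep_pow_fin (\<eta> a) \<longleftrightarrow> \<psi> x \<le> a)"
      proof (intro eventually_ball_finite fin ballI)
        fix x assume x: "x \<in> B"
        show "\<forall>\<^sub>F k in sequentially. k \<in> R x \<longrightarrow> (k \<in> rep_pow_fin (\<eta> a) \<longleftrightarrow> \<psi> x \<le> a)"
        proof (cases "\<psi> x \<le> a")
          case True
          then have "inf (\<eta> (\<psi> x)) (\<eta> a) = \<eta> (\<psi> x)"
            using boolean_hom_mono[OF \<eta>(1)] by (simp add: inf.absorb1)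
          then show ?thesis using eventually_rep_inf[of "\<eta> (\<psi> x)" "\<eta> a"]
            by (auto simp: R_def True elim: eventually_mono)
        next
          case False
          then have "inf (\<psi> x) a = bot" using decidesD[OF P a] x im by blast
          from eventually_rep_disjoint[OF \<eta>_disj[OF this]] show ?thesis
            by (auto simp: R_def False elim: eventually_mono)
        qed
      qed
      then show ?thesis using fR by eventually_elim (use fB in blast)
    qed
  qed
qed

text \<open>The itinerary is taken along the partition \<open>A'\<close> that realizes
  \<open>B\<close> and is labelled by \<open>B\<close>. It lifts \<open>\<eta>\<close> on all
  elements decided by \<open>A\<close> because \<open>x\<close> and \<open>\<psi> x\<close> lie over
  the same member of \<open>A\<close>.\<close>

lemma lifted_itinerary:
  fixes \<alpha> :: "'a::boolean_algebra \<Rightarrow> 'a" and \<beta> :: "'b::boolean_algebra \<Rightarrow> 'b"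
  assumes "countable (UNIV :: 'b set)" and "dynamical_system \<beta>" and "incompressible \<beta>"
    and \<iota>: "embedding \<alpha> \<beta> \<iota>" and "polarized \<alpha>" and nontriv: "(bot :: 'b) \<noteq> top"
    and \<eta>: "embedding \<alpha> shift \<eta>"
    and A: "is_partition A" and B: "is_partition B" and ref: "refines_partition B (\<iota> ` A)"
  obtains f :: "nat \<Rightarrow> 'b" where "\<And>k. f k \<in> B"
    and "\<And>x. x \<in> B \<Longrightarrow> \<exists>\<^sub>F k in sequentially. f k = x"
    and "\<forall>\<^sub>F k in sequentially. inf (\<beta> (f k)) (f (Suc k)) \<noteq> bot"
    and "\<And>a. decides A a \<Longrightarrow>
      \<forall>\<^sub>F k in sequentially. k \<in> rep_pow_fin (\<eta> a) \<longleftrightarrow> f k \<le> \<iota> a"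
proof -
  have \<iota>_hom: "boolean_hom \<iota>" "inj \<iota>" using \<iota> by (auto simp: embedding_def)
  obtain \<psi> A' where A': "is_partition A'" and im: "\<psi> ` B = A'" and inj: "inj_on \<psi> B"
    and arcs: "\<And>x y. x \<in> B \<Longrightarrow> y \<in> B \<Longrightarrow> inf (\<beta> x) y = bot \<Longrightarrow> inf (\<alpha> (\<psi> x)) (\<psi> y) = bot"
    and le: "\<And>x a. x \<in> B \<Longrightarrow> a \<in> A \<Longrightarrow> x \<le> \<iota> a \<Longrightarrow> \<psi> x \<le> a"
    by (rule polarized_realization[OF assms(1-6) A B ref]) blast
  have above: "\<exists>a'\<in>A. x \<le> \<iota> a' \<and> \<psi> x \<le> a'" if "x \<in> B" for x
    using ref that le by (fastforce simp: refines_partition_def)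
  have dec: "decides A' a" "\<And>x. x \<in> B \<Longrightarrow> \<psi> x \<le> a \<longleftrightarrow> x \<le> \<iota> a" if a: "decides A a" for a
  proof -
    \<comment> \<open>Whichever side of \<open>a\<close> the common member \<open>a'\<close> falls
      on takes \<open>\<psi> x\<close> and \<open>x\<close> with it; both being nonzero, the two
      alternatives exclude each other.\<close>
    have *: "\<psi> x \<le> a \<and> x \<le> \<iota> a \<or> \<psi> x \<le> - a \<and> x \<le> - \<iota> a" if x: "x \<in> B" for x
    proof -
      obtain a' where a': "a' \<in> A" "x \<le> \<iota> a'" "\<psi> x \<le> a'" using above x by blast
      have "\<iota> (- a) = - \<iota> a" using \<iota>_hom by (simp add: boolean_hom_def)
      moreover have "a' \<le> a \<or> a' \<le> - a" using a a'(1) by (simp add: decides_def)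
      then have "a' \<le> a \<and> \<iota> a' \<le> \<iota> a \<or> a' \<le> - a \<and> \<iota> a' \<le> \<iota> (- a)"
        using boolean_hom_mono[OF \<iota>_hom(1)] by blast
      ultimately show ?thesis using a'(2,3) by (auto intro: order_trans)
    qed
    show "decides A' a" using * im by (auto simp: decides_def)
    show "\<psi> x \<le> a \<longleftrightarrow> x \<le> \<iota> a" if x: "x \<in> B" for x
    proof -
      have "\<not> (\<psi> x \<le> a \<and> \<psi> x \<le> - a)"
        using x im partition_nonbot[OF A', of "\<psi> x"] by (auto simp flip: le_inf_iff simp: bot_unique)
      moreover have "\<not> (x \<le> \<iota> a \<and> x \<le> - \<iota> a)"
        using x partition_nonbot[OF B, of x] by (auto simp flip: le_inf_iff simp: bot_unique)
      ultimately show ?thesis using *[OF x] by blast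
    qed
  qed
  obtain f where f: "\<And>k. f k \<in> B" "\<And>x. x \<in> B \<Longrightarrow> \<exists>\<^sub>F k in sequentially. f k = x"
    "\<forall>\<^sub>F k in sequentially. inf (\<alpha> (\<psi> (f k))) (\<psi> (f (Suc k))) \<noteq> bot"
    "\<And>a. decides A' a \<Longrightarrow>
      \<forall>\<^sub>F k in sequentially. k \<in> rep_pow_fin (\<eta> a) \<longleftrightarrow> \<psi> (f k) \<le> a"
    by (rule embedding_shift_itinerary[OF \<eta> A' bij_betw_imageI[OF inj im] partition_nonempty[OF B nontriv]])
      blast
  show thesis
  proof
    show "\<forall>\<^sub>F k in sequentially. inf (\<beta> (f k)) (f (Suc k)) \<noteq> bot"
      using f(3) by eventually_elim (use arcs f(1) in blast)
    show "\<forall>\<^sub>F k in sequentially. k \<in> rep_pow_fin (\<eta> a) \<longleftrightarrow> f k \<le> \<iota> a" if "decides A a" for a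
      using f(4)[OF dec(1)[OF that]] dec(2)[OF that f(1)] by simp
  qed (use f in auto)
qed


section \<open>Diagonal walks\<close>

text \<open>Pairs of indices are coloured by whether their sequences agree infinitely often. An
  infinite homogeneous set of the negative colour would contain \<open>card P + 1\<close> sequences
  whose values in \<open>P\<close> are pairwise distinct from some time on, which is
  impossible.\<close>

lemma frequently_agreeing_subfamily:
  fixes h :: "nat \<Rightarrow> nat \<Rightarrow> 'c"
  assumes "finite P" and "infinite I" and hP: "\<And>m k. m \<in> I \<Longrightarrow> h m k \<in> P"
  obtains Y where "Y \<subseteq> I" and "infinite Y"
    and "\<And>m m'. m \<in> Y \<Longrightarrow> m' \<in> Y \<Longrightarrow> \<exists>\<^sub>F k in sequentially. h m k = h m' k"
proof -
  define agree where "agree m m' \<longleftrightarrow> (\<exists>\<^sub>F k in sequentially. h m k = h m' k)" for m m'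
  have sym: "agree m m' \<longleftrightarrow> agree m' m" for m m' by (simp add: agree_def eq_commute)
  \<comment> \<open>A colouring of unordered pairs must be a function of the set
    \<open>{m, m'}\<close>; the symmetry of \<open>agree\<close> determines its value from either
    order.\<close>
  define col where "col X = (if \<exists>m\<in>X. \<exists>m'\<in>X. m \<noteq> m' \<and> agree m m' then 1 else 0 :: nat)" for X
  have col: "col {m, m'} = (if agree m m' then 1 else 0)" if "m \<noteq> m'" for m m'
    using that sym by (auto simp: col_def)
  have "\<forall>x\<in>I. \<forall>y\<in>I. x \<noteq> y \<longrightarrow> col {x, y} < 2" by (simp add: col)
  from Ramsey2[OF assms(2) this]
  obtain Y t where Y: "Y \<subseteq> I" "infinite Y" and t: "\<forall>x\<in>Y. \<forall>y\<in>Y. x \<noteq> y \<longrightarrow> col {x, y} = t"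
    by blast
  have "agree m m'" if "m \<in> Y" "m' \<in> Y" for m m'
  proof (cases "m = m'")
    case False
    show ?thesis
    proof (rule ccontr)
      assume "\<not> agree m m'"
      then have "t = 0" using t that False col[of m m'] by simp
      then have dis: "\<not> agree x y" if "x \<in> Y" "y \<in> Y" "x \<noteq> y" for x y
        using t that col[of x y] by (auto split: if_splits)
      obtain S where S: "S \<subseteq> Y" "finite S" "card S = Suc (card P)"
        using infinite_arbitrarily_large[OF Y(2)] by blast
      have "\<forall>\<^sub>F k in sequentially. \<forall>x\<in>S. \<forall>y\<in>S. x \<noteq> y \<longrightarrow> h x k \<noteq> h y k"
      proof (intro eventually_ball_finite S(2) ballI)
        fix x y assume "x \<in> S" "y \<in> S"
        then show "\<forall>\<^sub>F k in sequentially. x \<noteq> y \<longrightarrow> h x k \<noteq> h y k"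
          using dis[of x y] S(1) by (cases "x = y") (auto simp: agree_def not_frequently)
      qed
      then obtain k where "\<forall>x\<in>S. \<forall>y\<in>S. x \<noteq> y \<longrightarrow> h x k \<noteq> h y k"
        using eventually_happens[of _ sequentially] trivial_limit_sequentially by blast
      then have "inj_on (\<lambda>x. h x k) S" by (auto simp: inj_on_def)
      moreover have "(\<lambda>x. h x k) ` S \<subseteq> P" using S(1) Y(1) hP by auto
      ultimately have "card S \<le> card P" using card_inj_on_le assms(1) by blast
      then show False using S(3) by simp
    qed
  qed (simp add: agree_def)
  then show thesis using that Y by (simp add: agree_def)
qed

text \<open>Repeating the selection gives infinite sets \<open>Y i\<close>, each containing the
  next, such that any two indices in \<open>Y i\<close> agree infinitely often under
  \<open>h i\<close>. Both \<open>m i\<close> and \<open>m (Suc i)\<close> belong to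
  \<open>Y i\<close>.\<close>

lemma frequently_agreeing_sequence:
  fixes h :: "nat \<Rightarrow> nat \<Rightarrow> nat \<Rightarrow> 'c"
  assumes "\<And>i. finite (P i)" and "\<And>i m k. i \<le> m \<Longrightarrow> h i m k \<in> P i"
  obtains m :: "nat \<Rightarrow> nat" where "\<And>i. i \<le> m i"
    and "\<And>i. \<exists>\<^sub>F k in sequentially. h i (m i) k = h i (m (Suc i)) k"
proof -
  define good where "good i Y \<longleftrightarrow> infinite Y \<and> Y \<subseteq> {i..} \<and>
    (\<forall>m\<in>Y. \<forall>m'\<in>Y. \<exists>\<^sub>F k in sequentially. h i m k = h i m' k)" for i and Y :: "nat set"
  have step: "\<exists>Y. good i Y \<and> Y \<subseteq> I" if "infinite I" for I i
  proof -
    \<comment> \<open>Indices below \<open>i\<close> are dropped first, as \<open>h i m\<close> is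
      known to take values in \<open>P i\<close> only for \<open>m \<ge> i\<close>.\<close>
    have "I \<subseteq> (I \<inter> {i..}) \<union> {..<i}" by auto
    then have "infinite (I \<inter> {i..})" using that by (meson finite_Un finite_lessThan finite_subset)
    then obtain Y where "Y \<subseteq> I \<inter> {i..}" "infinite Y"
      "\<And>m m'. m \<in> Y \<Longrightarrow> m' \<in> Y \<Longrightarrow> \<exists>\<^sub>F k in sequentially. h i m k = h i m' k"
      using frequently_agreeing_subfamily[of "P i" "I \<inter> {i..}" "h i"] assms by auto
    then show ?thesis unfolding good_def by blast
  qed
  have "\<exists>Y. \<forall>i. good i (Y i) \<and> Y (Suc i) \<subseteq> Y i"
  proof (rule dependent_nat_choice)
    show "\<exists>Y. good 0 Y" using step[of UNIV] by auto
    show "\<exists>Y'. good (Suc i) Y' \<and> Y' \<subseteq> Y" if "good i Y" for Y i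
      using step that by (simp add: good_def)
  qed
  then obtain Y where Y: "\<And>i. good i (Y i)" "\<And>i. Y (Suc i) \<subseteq> Y i" by blast
  define m where "m i = (SOME x. x \<in> Y i)" for i
  have m: "m i \<in> Y i" for i
    using Y(1)[of i] by (auto simp: m_def good_def some_in_eq)
  show thesis
  proof
    show "i \<le> m i" for i using Y(1)[of i] m[of i] by (auto simp: good_def)
    show "\<exists>\<^sub>F k in sequentially. h i (m i) k = h i (m (Suc i)) k" for i
      using Y(1)[of i] Y(2)[of i] m[of i] m[of "Suc i"] unfolding good_def by blast
  qed
qed

text \<open>The value \<open>c k\<close> tells which item is in force at time \<open>k\<close>. Item
  \<open>i\<close> rules from \<open>K i\<close> up to \<open>K (Suc i)\<close>; these times are
  chosen one after the other so that \<open>T i\<close> holds from \<open>K i\<close> on,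
  \<open>E i\<close> holds at the changeover \<open>K (Suc i)\<close>, and every \<open>x\<close> in
  \<open>X i\<close> has been met in between.\<close>

lemma switching_times:
  fixes T E :: "nat \<Rightarrow> nat \<Rightarrow> bool" and D :: "nat \<Rightarrow> 'c \<Rightarrow> nat \<Rightarrow> bool"
  assumes T: "\<And>i. \<forall>\<^sub>F k in sequentially. T i k" and E: "\<And>i. \<exists>\<^sub>F k in sequentially. E i k"
    and X: "\<And>i. finite (X i)" and D: "\<And>i x. x \<in> X i \<Longrightarrow> \<exists>\<^sub>F k in sequentially. D i x k"
  obtains c :: "nat \<Rightarrow> nat" where "\<And>n. \<forall>\<^sub>F k in sequentially. n \<le> c k"
    and "\<forall>\<^sub>F k in sequentially. T (c k) k"
    and "\<forall>\<^sub>F k in sequentially. c (Suc k) = c k \<or> c (Suc k) = Suc (c k) \<and> E (c k) (Suc k)"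
    and "\<And>i x. x \<in> X i \<Longrightarrow> \<exists>k. c k = i \<and> D i x k"
proof -
  have "\<exists>K. \<forall>i. (\<forall>k\<ge>K i. T i k) \<and>
    (K i < K (Suc i) \<and> E i (K (Suc i)) \<and> (\<forall>x\<in>X i. \<exists>k\<ge>K i. k < K (Suc i) \<and> D i x k))"
  proof (rule dependent_nat_choice)
    show "\<exists>K. \<forall>k\<ge>K. T 0 k" using T by (simp add: eventually_sequentially)
  next
    fix K i
    have "\<exists>d. \<forall>x\<in>X i. K \<le> d x \<and> D i x (d x)"
      using D by (intro bchoice) (simp add: frequently_sequentially)
    then obtain d where d: "\<And>x. x \<in> X i \<Longrightarrow> K \<le> d x \<and> D i x (d x)" by blast
    obtain N where N: "\<And>k. k \<ge> N \<Longrightarrow> T (Suc i) k"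
      using T by (auto simp: eventually_sequentially)
    \<comment> \<open>The maximum puts \<open>K'\<close> after \<open>K\<close> and all the visiting
      times \<open>d x\<close>, and past the threshold for \<open>T (Suc i)\<close>. As
      \<open>E i\<close> recurs, it holds at some such time.\<close>
    obtain K' where K': "K' \<ge> Max (insert (Suc K) (insert N (Suc ` d ` X i)))" "E i K'"
      using E by (auto simp: frequently_sequentially)
    then have "Suc K \<le> K'" "N \<le> K'" "\<And>x. x \<in> X i \<Longrightarrow> Suc (d x) \<le> K'"
      using X by auto
    then show "\<exists>K'. (\<forall>k\<ge>K'. T (Suc i) k) \<and>
      (K < K' \<and> E i K' \<and> (\<forall>x\<in>X i. \<exists>k\<ge>K. k < K' \<and> D i x k))"
      using N d K'(2) by (intro exI[of _ K']) (auto simp: Suc_le_eq)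
  qed
  then obtain K where KT: "\<And>i k. k \<ge> K i \<Longrightarrow> T i k" and KE: "\<And>i. E i (K (Suc i))"
    and Ksm: "strict_mono K" and KD: "\<And>i x. x \<in> X i \<Longrightarrow> \<exists>k\<ge>K i. k < K (Suc i) \<and> D i x k"
    unfolding strict_mono_Suc_iff by blast
  \<comment> \<open>Since \<open>K\<close> increases, this is the number of the current block. Times
    before \<open>K 0\<close> also get the value 0, so the claims about blocks start at
    \<open>K 0\<close>.\<close>
  define c where "c k = (LEAST i. k < K (Suc i))" for k
  have c_eq: "c k = i" if "K i \<le> k" "k < K (Suc i)" for i k
    unfolding c_def
  proof (rule Least_equality)
    show "i \<le> j" if "k < K (Suc j)" for j
      using \<open>K i \<le> k\<close> that strict_mono_less[OF Ksm, of i "Suc j"] by simp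
  qed (rule that)
  have c: "k < K (Suc (c k))" "k \<ge> K 0 \<Longrightarrow> K (c k) \<le> k" for k
  proof -
    have "k < K (Suc k)" using strict_mono_imp_increasing[OF Ksm, of "Suc k"] by simp
    then show "k < K (Suc (c k))" unfolding c_def by (rule LeastI)
    show "K (c k) \<le> k" if "k \<ge> K 0"
    proof (cases "c k")
      case (Suc j)
      then show ?thesis using not_less_Least[of j "\<lambda>i. k < K (Suc i)"] by (simp add: c_def)
    qed (use that in simp)
  qed
  show thesis
  proof
    show "\<forall>\<^sub>F k in sequentially. n \<le> c k" for n
      using eventually_ge_at_top[of "K n"]
    proof eventually_elim
      case (elim k)
      then have "K n < K (Suc (c k))" using c(1)[of k] by simp
      then show ?case using strict_mono_less[OF Ksm] by simp
    qed
    show "\<forall>\<^sub>F k in sequentially. T (c k) k"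
      using eventually_ge_at_top[of "K 0"] by eventually_elim (use c(2) KT in blast)
    show "\<forall>\<^sub>F k in sequentially. c (Suc k) = c k \<or> c (Suc k) = Suc (c k) \<and> E (c k) (Suc k)"
      using eventually_ge_at_top[of "K 0"]
    proof eventually_elim
      case (elim k)
      show ?case
      proof (cases "Suc k < K (Suc (c k))")
        case True
        then show ?thesis using c(2)[OF elim] by (intro disjI1 c_eq) simp_all
      next
        case False
        \<comment> \<open>The time \<open>k\<close> lies before the end of its block, so a successor
          outside the block is exactly the changeover time.\<close>
        then have *: "Suc k = K (Suc (c k))" using c(1)[of k] by simp
        then have "c (Suc k) = Suc (c k)"
          using strict_mono_less[OF Ksm] by (intro c_eq) simp_all
        then show ?thesis using KE[of "c k"] * by simp
      qed
    qed
    show "\<exists>k. c k = i \<and> D i x k" if "x \<in> X i" for i x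
      using KD[OF that] c_eq by blast
  qed
qed

section \<open>Embeddings defined by walks\<close>

lemma boolean_hom_injI:
  assumes "boolean_hom f" and "\<And>x. f x = bot \<Longrightarrow> x = bot"
  shows "inj f"
proof (rule injI)
  fix x y assume "f x = f y"
  moreover have "f (inf u (- v)) = inf (f u) (- f v)" for u v
    using assms(1) by (simp add: boolean_hom_def)
  ultimately have "f (inf x (- y)) = bot" "f (inf y (- x)) = bot" by simp_all
  then have "inf x (- y) = bot" "inf y (- x) = bot" using assms(2) by blast+
  then have "x \<le> y" "y \<le> x" by (simp_all add: inf_shunt)
  then show "x = y" by (rule antisym)
qed

text \<open>Meets are preserved since \<open>f k \<le> inf x y\<close> splits; complements use
  \<open>dec\<close> and that \<open>f k\<close> is nonzero; joins follow by De Morgan. Commutation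
  with the shift comes from \<open>step\<close>, and \<open>visit\<close> gives a trivial kernel,
  hence injectivity.\<close>

lemma embedding_of_itinerary:
  fixes \<beta> :: "'b::boolean_algebra \<Rightarrow> 'b" and f :: "nat \<Rightarrow> 'b"
  assumes "boolean_hom \<beta>" and nonbot: "\<And>k. f k \<noteq> bot"
    and dec: "\<And>b. \<forall>\<^sub>F k in sequentially. f k \<le> b \<or> f k \<le> - b"
    and step: "\<And>b. \<forall>\<^sub>F k in sequentially. f (Suc k) \<le> \<beta> b \<longleftrightarrow> f k \<le> b"
    and visit: "\<And>b. b \<noteq> bot \<Longrightarrow> \<exists>\<^sub>F k in sequentially. f k \<le> b"
  shows "embedding \<beta> shift (\<lambda>b. class_mod_fin {k. f k \<le> b})"
proof -
  define \<eta>' where "\<eta>' b = class_mod_fin {k. f k \<le> b}" for b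
  have inf: "\<eta>' (inf x y) = inf (\<eta>' x) (\<eta>' y)" for x y
    by (simp add: \<eta>'_def inf_pow_fin.abs_eq class_mod_fin_eq_iff)
  have not_both: "\<not> (f k \<le> x \<and> f k \<le> - x)" for k x
    using nonbot[of k] by (auto simp flip: le_inf_iff simp: bot_unique)
  have uminus: "\<eta>' (- x) = - \<eta>' x" for x
    unfolding \<eta>'_def uminus_pow_fin.abs_eq class_mod_fin_eq_iff
    using dec[of x] by eventually_elim (use not_both in auto)
  have sup: "\<eta>' (sup x y) = sup (\<eta>' x) (\<eta>' y)" for x y
  proof -
    have "\<eta>' (sup x y) = \<eta>' (- inf (- x) (- y))" by simp
    also have "\<dots> = sup (\<eta>' x) (\<eta>' y)" unfolding uminus inf by simp
    finally show ?thesis .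
  qed
  have "\<eta>' bot = bot" "\<eta>' top = top"
    by (simp_all add: \<eta>'_def bot_pow_fin.abs_eq top_pow_fin.abs_eq nonbot bot_unique)
  then have hom: "boolean_hom \<eta>'" by (simp add: boolean_hom_def inf sup uminus)
  moreover have "inj \<eta>'"
  proof (rule boolean_hom_injI[OF hom], rule ccontr)
    fix x assume x: "\<eta>' x = bot" "x \<noteq> bot"
    then have "\<forall>\<^sub>F k in sequentially. \<not> f k \<le> x"
      by (simp add: \<eta>'_def bot_pow_fin.abs_eq class_mod_fin_eq_iff)
    then show False using visit[OF x(2)] by (simp add: frequently_def)
  qed
  moreover have "\<eta>' (\<beta> x) = shift (\<eta>' x)" for x
  proof -
    have "\<forall>\<^sub>F k in sequentially. Suc k \<in> {k. f k \<le> \<beta> x} \<longleftrightarrow> Suc k \<in> Suc ` {k. f k \<le> x}"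
      using step[of x] by eventually_elim auto
    then have "\<forall>\<^sub>F k in sequentially. k \<in> {k. f k \<le> \<beta> x} \<longleftrightarrow> k \<in> Suc ` {k. f k \<le> x}"
      by (subst (asm) eventually_sequentially_Suc)
    then show ?thesis by (simp only: \<eta>'_def shift.abs_eq class_mod_fin_eq_iff)
  qed
  ultimately have "embedding \<beta> shift \<eta>'" by (simp add: embedding_def fun_eq_iff)
  then show ?thesis by (simp add: \<eta>'_def[abs_def])
qed

section \<open>The diagonal walk and the extension of \<eta>\<close>

theorem theorem9p6:
  fixes \<alpha> :: "'a::boolean_algebra \<Rightarrow> 'a"
    and \<beta> :: "'b::boolean_algebra \<Rightarrow> 'b"
    and \<iota> :: "'a \<Rightarrow> 'b"
    and \<eta> :: "'a \<Rightarrow> pow_fin"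
  assumes "countable (UNIV :: 'a set)" and "dynamical_system \<alpha>" and "incompressible \<alpha>"
    and "countable (UNIV :: 'b set)" and "dynamical_system \<beta>" and "incompressible \<beta>"
    and "embedding \<alpha> \<beta> \<iota>"
    and "embedding \<alpha> shift \<eta>"
    and "polarized \<alpha>"
  shows "\<exists>\<eta>' :: 'b \<Rightarrow> pow_fin. embedding \<beta> shift \<eta>' \<and> \<eta>' \<circ> \<iota> = \<eta>"
proof -
  have \<iota>: "boolean_hom \<iota>" "inj \<iota>" using assms(7) by (auto simp: embedding_def)
  have \<beta>: "boolean_hom \<beta>" using assms(5) by (auto simp: dynamical_system_def)
  \<comment> \<open>If the second algebra were degenerate, injectivity of \<open>\<iota>\<close>
    would make the first one degenerate, and \<open>\<eta>\<close> would then identify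
    \<open>bot\<close> and \<open>top\<close> among the classes.\<close>
  have "(bot :: pow_fin) \<noteq> top"
    by (simp add: bot_pow_fin.abs_eq top_pow_fin.abs_eq class_mod_fin_eq_iff)
  then have nontriv: "(bot :: 'b) \<noteq> top"
    using assms(7,8) by (metis boolean_hom_def embedding_def injD)
  define a :: "nat \<Rightarrow> 'a" where "a = from_nat_into UNIV"
  define b :: "nat \<Rightarrow> 'b" where "b = from_nat_into UNIV"
  have a: "\<exists>j. x = a j" for x
    using from_nat_into_surj[OF assms(1), of x] by (auto simp: a_def)
  have b: "\<exists>j. x = b j" for x
    using from_nat_into_surj[OF assms(4), of x] by (auto simp: b_def)
  obtain A where A: "\<And>n. is_partition (A n)" "\<And>n. refines_partition (A (Suc n)) (A n)"
    "\<And>n j. j < n \<Longrightarrow> decides (A n) (a j)"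
    using deciding_partitions[of a] by blast
  obtain B' where B': "\<And>n. is_partition (B' n)" "\<And>n. refines_partition (B' (Suc n)) (B' n)"
    "\<And>n j. j < n \<Longrightarrow> decides (B' n) (b j)"
    using deciding_partitions[of b] by blast
  \<comment> \<open>Refining the image of \<open>A n\<close> makes \<open>B n\<close> a virtual
    refinement of \<open>A n\<close>; refining \<open>B' n\<close> makes it decide the first
    \<open>n\<close> elements of the enumeration \<open>b\<close>.\<close>
  define B where "B n = common_refinement (B' n) (\<iota> ` A n)" for n
  have B: "is_partition (B n)" for n
    unfolding B_def by (intro is_partition_common_refinement partition_image A B' \<iota>)
  have B_A: "refines_partition (B n) (\<iota> ` A n)" and B_B': "refines_partition (B n) (B' n)" for n
    by (simp_all add: B_def refines_common_refinement)
  have "refines_partition (B (Suc n)) (B n)" for n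
    unfolding refines_partition_def
  proof
    fix x assume x: "x \<in> B (Suc n)"
    then have x0: "x \<noteq> bot" using partition_nonbot[OF B] by blast
    obtain u v where uv: "u \<in> B' (Suc n)" "v \<in> A (Suc n)" "x = inf u (\<iota> v)"
      using x by (auto simp: B_def common_refinement_def)
    obtain u' v' where uv': "u' \<in> B' n" "u \<le> u'" "v' \<in> A n" "v \<le> v'"
      using A(2)[of n] B'(2)[of n] uv(1,2) unfolding refines_partition_def by blast
    have le: "x \<le> inf u' (\<iota> v')"
      unfolding uv(3) using uv' boolean_hom_mono[OF \<iota>(1)] by (intro inf_mono) auto
    then have "inf u' (\<iota> v') \<noteq> bot" using x0 by (metis bot_unique)
    then have "inf u' (\<iota> v') \<in> B n"
      using uv' by (auto simp: B_def common_refinement_def)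
    then show "\<exists>y\<in>B n. x \<le> y" using le by blast
  qed
  then have B_mono: "refines_partition (B m) (B n)" if "n \<le> m" for n m
    using that
  proof (induction m)
    case 0
    then show ?case by (auto simp: refines_partition_def)
  next
    case (Suc m)
    then show ?case
      by (cases "n = Suc m") (auto simp: refines_partition_def[of "B (Suc m)" "B (Suc m)"]
          intro: refines_partition_trans)
  qed
  have B_dec: "decides (B n) (b j)" if "j < n" for n j
    using decides_refines[OF B_B' B'(3)[OF that]] .

  define lifts where "lifts n f \<longleftrightarrow>
      (\<forall>k. f k \<in> B n) \<and> (\<forall>x\<in>B n. \<exists>\<^sub>F k in sequentially. f k = x) \<and>
      (\<forall>\<^sub>F k in sequentially. inf (\<beta> (f k)) (f (Suc k)) \<noteq> bot) \<and>
      (\<forall>x. decides (A n) x \<longrightarrow>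
        (\<forall>\<^sub>F k in sequentially. k \<in> rep_pow_fin (\<eta> x) \<longleftrightarrow> f k \<le> \<iota> x))" for n f
  have "\<exists>f. lifts n f" for n
    unfolding lifts_def
    by (rule lifted_itinerary[OF assms(4-7) assms(9) nontriv assms(8) A(1) B B_A, of n])
      (rule exI, intro conjI allI ballI impI)
  then obtain f where lifts: "\<And>n. lifts n (f n)" by metis
  have f: "f n k \<in> B n"
    and f_visits: "x \<in> B n \<Longrightarrow> \<exists>\<^sub>F k in sequentially. f n k = x"
    and f_step: "\<forall>\<^sub>F k in sequentially. inf (\<beta> (f n k)) (f n (Suc k)) \<noteq> bot"
    and f_lift: "decides (A n) y \<Longrightarrow>
      \<forall>\<^sub>F k in sequentially. k \<in> rep_pow_fin (\<eta> y) \<longleftrightarrow> f n k \<le> \<iota> y" for n k x y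
    using lifts[of n] by (simp_all add: lifts_def)
  \<comment> \<open>The sequences \<open>f (m i)\<close> and \<open>f (m (Suc i))\<close> may live
    in different partitions, so they are compared after projection to \<open>B i\<close>, which both
    partitions refine.\<close>
  obtain m where m: "\<And>i. i \<le> m i" and agree: "\<And>i. \<exists>\<^sub>F k in sequentially.
      natural_map (B i) (f (m i) k) = natural_map (B i) (f (m (Suc i)) k)"
    using frequently_agreeing_sequence[of B "\<lambda>i m k. natural_map (B i) (f m k)"]
      partition_finite[OF B] natural_map_refines(1)[OF B B B_mono f] by blast
  \<comment> \<open>Only finitely many of the eventual properties of a sequence are demanded while
    it is followed; the number of elements on which it must lift \<open>\<eta>\<close> grows with
    \<open>i\<close>.\<close>
  define T where "T i k \<longleftrightarrow> inf (\<beta> (f (m i) k)) (f (m i) (Suc k)) \<noteq> bot \<and>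
    (\<forall>j<i. k \<in> rep_pow_fin (\<eta> (a j)) \<longleftrightarrow> f (m i) k \<le> \<iota> (a j))" for i k
  have T: "\<forall>\<^sub>F k in sequentially. T i k" for i
  proof -
    have "\<forall>\<^sub>F k in sequentially. \<forall>j\<in>{..<i}. k \<in> rep_pow_fin (\<eta> (a j)) \<longleftrightarrow> f (m i) k \<le> \<iota> (a j)"
      using A(3) m[of i] by (intro eventually_ball_finite ballI f_lift) auto
    then show ?thesis unfolding T_def using f_step by eventually_elim auto
  qed
  obtain c where c: "\<And>n. \<forall>\<^sub>F k in sequentially. n \<le> c k"
    and cT: "\<forall>\<^sub>F k in sequentially. T (c k) k"
    and cE: "\<forall>\<^sub>F k in sequentially. c (Suc k) = c k \<or> c (Suc k) = Suc (c k) \<and>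
      natural_map (B (c k)) (f (m (c k)) (Suc k)) = natural_map (B (c k)) (f (m (Suc (c k))) (Suc k))"
    and cD: "\<And>i x. x \<in> B (m i) \<Longrightarrow> \<exists>k. c k = i \<and> f (m i) k = x"
  \<comment> \<open>The changeover waits for agreement modulo \<open>B i\<close>, and each sequence
    is followed until all members of its own partition \<open>B (m i)\<close> have been
    visited.\<close>
  proof (rule switching_times[of T
        "\<lambda>i k. natural_map (B i) (f (m i) k) = natural_map (B i) (f (m (Suc i)) k)"
        "\<lambda>i. B (m i)" "\<lambda>i x k. f (m i) k = x",
        OF T agree partition_finite[OF B]], goal_cases)
    case (1 i x)
    then show ?case by (intro f_visits)
  next
    case (2 c)
    show ?case by (rule that[OF 2(2-5)])
  qed
  define g where "g k = f (m (c k)) k" for k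
  have g: "g k \<in> B (m (c k))" for k by (simp add: g_def f)
  have "embedding \<beta> shift (\<lambda>x. class_mod_fin {k. g k \<le> x})"
  proof (rule embedding_of_itinerary[OF \<beta>])
    show "g k \<noteq> bot" for k using g partition_nonbot[OF B] by blast
  next
    fix x
    obtain j where j: "x = b j" using b by blast
    show "\<forall>\<^sub>F k in sequentially. g k \<le> x \<or> g k \<le> - x"
      using c[of "Suc j"]
    proof eventually_elim
      case (elim k)
      then have "j < m (c k)" using m[of "c k"] by simp
      then show ?case using B_dec g[of k] j by (auto simp: decides_def)
    qed
  next
    fix x
    obtain j j' where j: "x = b j" "\<beta> x = b j'" using b by metis
    show "\<forall>\<^sub>F k in sequentially. g (Suc k) \<le> \<beta> x \<longleftrightarrow> g k \<le> x"
      \<comment> \<open>From this bound on, \<open>B (c k)\<close> and \<open>B (m (c k))\<close>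
        decide both \<open>x\<close> and \<open>\<beta> x\<close>.\<close>
      using c[of "Suc (max j j')"] cT cE
    proof eventually_elim
      case (elim k)
      \<comment> \<open>\<open>?y\<close> is the next value of the sequence followed at time
        \<open>k\<close>. It can differ from \<open>g (Suc k)\<close> only at a changeover, and then
        both project to the same member of \<open>B ?i\<close>, which decides
        \<open>\<beta> x\<close>.\<close>
      let ?i = "c k" and ?y = "f (m (c k)) (Suc k)"
      have mi: "?i \<le> m ?i" "?i \<le> m (Suc ?i)" using m[of ?i] m[of "Suc ?i"] by auto
      have dec: "decides (B ?i) (\<beta> x)" "decides (B (m ?i)) x" "decides (B (m ?i)) (\<beta> x)"
        unfolding j(2) using elim(1) mi(1) by (auto simp: j(1) intro!: B_dec)
      have arc: "inf (\<beta> (g k)) ?y \<noteq> bot" using elim(2) by (simp add: T_def g_def)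
      have y: "?y \<in> B (m ?i)" by (rule f)
      have nb: "\<not> (z \<le> u \<and> z \<le> - u)" if "z \<in> B n" for z u n
        using partition_nonbot[OF B that] by (auto simp flip: le_inf_iff simp: bot_unique)
      have same: "z \<le> \<beta> x \<longleftrightarrow> natural_map (B ?i) z \<le> \<beta> x" if "z \<in> B n" "?i \<le> n" for z n
      proof -
        note nm = natural_map_refines[OF B B B_mono[OF that(2)] that(1)]
        show ?thesis using dec(1) nm nb[OF that(1), of "\<beta> x"] unfolding decides_def
          by (meson order_trans)
      qed
      have "g (Suc k) \<le> \<beta> x \<longleftrightarrow> ?y \<le> \<beta> x"
        using elim(3) same[OF f mi(1), of "Suc k"] same[OF f mi(2), of "Suc k"]
        by (auto simp: g_def)
      \<comment> \<open>\<open>\<beta> (g k)\<close> meets \<open>?y\<close>, while each of the two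
        lies below \<open>\<beta> x\<close> or below its complement; hence they lie on the same
        side.\<close>
      also have "\<dots> \<longleftrightarrow> g k \<le> x"
      proof
        assume "g k \<le> x"
        then have "inf ?y (\<beta> x) \<noteq> bot"
          using arc boolean_hom_mono[OF \<beta>, of "g k" x] by (metis inf_neq_bot_mono inf_commute order_refl)
        then show "?y \<le> \<beta> x" using decidesD[OF B dec(3) y] by blast
      next
        assume le: "?y \<le> \<beta> x"
        show "g k \<le> x"
        proof (rule ccontr)
          assume "\<not> g k \<le> x"
          then have "g k \<le> - x" using dec(2) g[of k] by (auto simp: decides_def)
          then have "\<beta> (g k) \<le> - \<beta> x"
            using boolean_hom_mono[OF \<beta>, of "g k" "- x"] \<beta> by (simp add: boolean_hom_def)
          then have "inf (- \<beta> x) (\<beta> x) \<noteq> bot" using arc le inf_neq_bot_mono by blast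
          then show False by simp
        qed
      qed
      finally show ?case .
    qed
  next
    fix x :: 'b assume x: "x \<noteq> bot"
    obtain j where j: "x = b j" using b by blast
    have "\<exists>k. c k = i \<and> g k \<le> x" if i: "j < i" for i
    proof -
      obtain y where y: "y \<in> B (m i)" "inf x y \<noteq> bot" using partition_meets[OF B x] by blast
      have "decides (B (m i)) x" using i m[of i] by (simp add: j B_dec)
      then have "y \<le> x" using decidesD[OF B _ y(1)] y(2) by (simp add: inf_commute)
      then show ?thesis using cD[OF y(1)] by (auto simp: g_def)
    qed
    \<comment> \<open>There is a visit below \<open>x\<close> in every block numbered above
      \<open>j\<close>, and times with different values of \<open>c\<close> are distinct, so there
      are infinitely many visits.\<close>
    then have "{Suc j..} \<subseteq> c ` {k. g k \<le> x}" by (force simp: Suc_le_eq)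
    then have "infinite {k. g k \<le> x}" by (meson finite_imageI finite_subset infinite_Ici)
    then show "\<exists>\<^sub>F k in sequentially. g k \<le> x"
      by (simp add: frequently_cofinite flip: cofinite_eq_sequentially)
  qed
  moreover have "class_mod_fin {k. g k \<le> \<iota> x} = \<eta> x" for x
  proof -
    obtain j where j: "x = a j" using a by blast
    have "\<forall>\<^sub>F k in sequentially. k \<in> {k. g k \<le> \<iota> x} \<longleftrightarrow> k \<in> rep_pow_fin (\<eta> x)"
      \<comment> \<open>Once \<open>c k\<close> exceeds \<open>j\<close>, the lifting clause of
        \<open>T\<close> covers \<open>a j\<close>.\<close>
      using c[of "Suc j"] cT by eventually_elim (auto simp: T_def g_def j)
    then have "class_mod_fin {k. g k \<le> \<iota> x} = class_mod_fin (rep_pow_fin (\<eta> x))"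
      by (simp only: class_mod_fin_eq_iff)
    then show ?thesis by simp
  qed
  ultimately show ?thesis
    by (intro exI[of _ "\<lambda>x. class_mod_fin {k. g k \<le> x}"]) (simp add: fun_eq_iff)
qed

end
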